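(* Let $\delta,\rho,\beta>0$ with $\beta<1+\frac\rho\delta$. For each fixed $x>0$, there exists a unique solution in the set $\mathcal C_{x,\infty}$ to the integro-differential equation $$\frac{\mathrm d}{\mathrm ds}z_s=e^{(\rho+2\delta)s}\int_s^{+\infty}e^{-(\rho+\delta-\delta\beta)u}z_u^{-\beta}\,\mathrm du,\quad s\ge0,\qquad z_0=x,$$ and this solution is twice continuously differentiable. Moreover, the integro-differential equation $$\frac{\mathrm d}{\mathrm ds}y_s=-\delta y_s+\int_s^{+\infty}e^{-(\rho+\delta)(u-s)}y_u^{-\beta}\,\mathrm du,\quad s\ge0,\qquad y_0=x,\qquad(\ast)$$ admits a unique solution $y\in C^2([0,+\infty);(0,+\infty))$ satisfying the bounds $$e^{-\delta s}x\le y_s\le e^{-\delta s}\left[x-\frac{x^{-\beta}}{\delta(1+\beta)(\rho+\delta-\delta\beta)}\right]+\frac{e^{\delta\beta s}x^{-\beta}}{\delta(1+\beta)(\rho+\delta-\delta\beta)},\quad s\ge0.$$ Finally, set $y_\infty:=(\delta(\rho+\delta))^{-\frac1{\beta+1}}$. If $x=y_\infty$, then the function $y_s=y_\infty$, for all $s\ge0$, is the unique constant solution to $(\ast)$. If, instead, $x\ne y_\infty$, then the corresponding solution $y$ to $(\ast)$ is strictly monotone and $\lim_{s\to+\infty}y_s=y_\infty$.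
   Context: For $x>0$, with $\beta<1+\rho/\delta$, let $$\overline\alpha^{x,\infty}_s:=x-\frac{x^{-\beta}}{\rho+\delta-\delta\beta}\cdot\frac{1-e^{\delta(1+\beta)s}}{\delta(1+\beta)},\quad s\ge0,$$ and $\mathcal C_{x,\infty}:=\{f\in C([0,+\infty);(0,+\infty)):\ x\le f_s\le\overline\alpha^{x,\infty}_s\ \ \forall s\ge0\}$. A solution of either integro-differential equation is a positive $C^1$ function on $[0,\infty)$ satisfying the equation for every $s\ge0$, or equivalently a positive continuous function satisfying the corresponding integral equation: $z_s=x+\int_0^se^{(\rho+2\delta)r}\int_r^{+\infty}e^{-(\rho+\delta-\delta\beta)u}z_u^{-\beta}\,\mathrm du\,\mathrm dr$, respectively $y_s=e^{-\delta s}x+\int_0^se^{-\delta(s-r)}\int_r^{+\infty}e^{-(\rho+\delta)(u-r)}y_u^{-\beta}\,\mathrm du\,\mathrm dr$, for all $s\ge0$. "The corresponding solution" for $x\neq y_\infty$ is the unique solution satisfying the stated bounds. *)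

theory Defs
  imports "HOL-Analysis.Analysis"
begin

text \<open>Functions on \<open>[0,\<infinity>)\<close> are represented by total functions \<open>real \<Rightarrow> real\<close>; only their values
  on \<open>{0..}\<close> are relevant, and derivatives at \<open>0\<close> are one-sided.\<close>

primrec Ck_on :: "nat \<Rightarrow> real set \<Rightarrow> (real \<Rightarrow> real) \<Rightarrow> bool" where
  "Ck_on 0 S f \<longleftrightarrow> continuous_on S f"
| "Ck_on (Suc k) S f \<longleftrightarrow>
     (\<exists>f'. (\<forall>s\<in>S. (f has_real_derivative f' s) (at s within S)) \<and> Ck_on k S f')"

definition alpha_bar :: "real \<Rightarrow> real \<Rightarrow> real \<Rightarrow> real \<Rightarrow> real \<Rightarrow> real" where
  "alpha_bar \<delta> \<rho> \<beta> x s =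
     x - x powr (-\<beta>) / (\<rho> + \<delta> - \<delta> * \<beta>) * ((1 - exp (\<delta> * (1 + \<beta>) * s)) / (\<delta> * (1 + \<beta>)))"

definition C_set :: "real \<Rightarrow> real \<Rightarrow> real \<Rightarrow> real \<Rightarrow> (real \<Rightarrow> real) set" where
  "C_set \<delta> \<rho> \<beta> x =
     {f. continuous_on {0..} f \<and> (\<forall>s\<ge>0. f s > 0) \<and>
         (\<forall>s\<ge>0. x \<le> f s \<and> f s \<le> alpha_bar \<delta> \<rho> \<beta> x s)}"

text \<open>The improper integrals have positive continuous integrands, so their convergence is Lebesgue
  integrability. It is required explicitly, because the Lebesgue integral of a non-integrable
  function is \<open>0\<close> by convention.\<close>

definition z_solution :: "real \<Rightarrow> real \<Rightarrow> real \<Rightarrow> real \<Rightarrow> (real \<Rightarrow> real) \<Rightarrow> bool" where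
  "z_solution \<delta> \<rho> \<beta> x z \<longleftrightarrow>
     Ck_on 1 {0..} z \<and> (\<forall>s\<ge>0. z s > 0) \<and> z 0 = x \<and>
     (\<forall>s\<ge>0.
        set_integrable lborel {s..} (\<lambda>u. exp (-(\<rho> + \<delta> - \<delta> * \<beta>) * u) * z u powr (-\<beta>)) \<and>
        (z has_real_derivative
           exp ((\<rho> + 2 * \<delta>) * s) *
           (LINT u:{s..}|lborel. exp (-(\<rho> + \<delta> - \<delta> * \<beta>) * u) * z u powr (-\<beta>)))
          (at s within {0..}))"

definition y_solution :: "real \<Rightarrow> real \<Rightarrow> real \<Rightarrow> real \<Rightarrow> (real \<Rightarrow> real) \<Rightarrow> bool" where
  "y_solution \<delta> \<rho> \<beta> x y \<longleftrightarrow>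
     Ck_on 1 {0..} y \<and> (\<forall>s\<ge>0. y s > 0) \<and> y 0 = x \<and>
     (\<forall>s\<ge>0.
        set_integrable lborel {s..} (\<lambda>u. exp (-(\<rho> + \<delta>) * (u - s)) * y u powr (-\<beta>)) \<and>
        (y has_real_derivative
           - \<delta> * y s + (LINT u:{s..}|lborel. exp (-(\<rho> + \<delta>) * (u - s)) * y u powr (-\<beta>)))
          (at s within {0..}))"

definition y_bounds :: "real \<Rightarrow> real \<Rightarrow> real \<Rightarrow> real \<Rightarrow> (real \<Rightarrow> real) \<Rightarrow> bool" where
  "y_bounds \<delta> \<rho> \<beta> x y \<longleftrightarrow>
     (\<forall>s\<ge>0.
        exp (-\<delta> * s) * x \<le> y s \<and>
        y s \<le> exp (-\<delta> * s) * (x - x powr (-\<beta>) / (\<delta> * (1 + \<beta>) * (\<rho> + \<delta> - \<delta> * \<beta>)))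
               + exp (\<delta> * \<beta> * s) * x powr (-\<beta>) / (\<delta> * (1 + \<beta>) * (\<rho> + \<delta> - \<delta> * \<beta>)))"

definition y_inf :: "real \<Rightarrow> real \<Rightarrow> real \<Rightarrow> real" where
  "y_inf \<delta> \<rho> \<beta> = (\<delta> * (\<rho> + \<delta>)) powr (- 1 / (\<beta> + 1))"

end

theory Submission
  imports Defs
begin

text \<open>Writing \<open>p\<close> for the integral term, the equation for \<open>y\<close> becomes the planar autonomous system
  \<open>y' = - \<delta> y + p\<close>, \<open>p' = (\<rho> + \<delta>) p - y powr - \<beta>\<close>, in which \<open>y\<close> is prescribed at \<open>0\<close> and \<open>p\<close> at infinity by
  \<open>exp (- (\<rho> + \<delta>) s) p s \<longlongrightarrow> 0\<close>; this decay is exactly what turns the differential equation for \<open>p\<close>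
  back into the improper integral (lemma \<open>y_solution_iff_solves_linear\<close>). The substitution
  \<open>z s = exp (\<delta> s) y s\<close> matches its solutions with those of the equation for \<open>z\<close>
  with the same \<open>x\<close>, and \<open>y_bounds\<close> with the inequalities in \<open>C_set\<close>, so everything is proved for \<open>y\<close>. The tools are two
  comparison principles: components fixed at infinity are compared backward, components fixed at
  \<open>0\<close> forward.

  Uniqueness. For two solutions with the same \<open>x\<close>, the product of the differences of \<open>y\<close> and of \<open>p\<close>,
  suitably weighted, is nondecreasing and starts at \<open>0\<close>, because the nonlinearity is decreasing.
  Knowing that this product is nonnegative, the squared weighted difference of \<open>p\<close> is
  nondecreasing too; as it tends to \<open>0\<close>, it vanishes (lemma \<open>decreasing_feedback_unique\<close>).

  Existence. Iterating the integral equation itself need not converge: at the steady state its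
  linearisation has size \<open>\<beta>\<close>, which may exceed \<open>1\<close>. But eliminating \<open>p\<close> gives
  \<open>y'' = \<rho> y' + \<kappa> y - y powr - \<beta>\<close> with \<open>\<kappa> = \<delta> (\<rho> + \<delta>)\<close>, whose right-hand side is increasing in \<open>y\<close>. Adding a
  large multiple of \<open>y\<close> on both sides amounts to replacing the rates \<open>\<delta>\<close> and \<open>\<rho> + \<delta>\<close> by large rates
  \<open>a\<close> and \<open>a + \<rho>\<close> and \<open>y powr - \<beta>\<close> by an increasing function with Lipschitz constant \<open>a (a + \<rho>) - \<kappa>\<close>. The
  linear solution operator has norm \<open>1 / (a (a + \<rho>))\<close>, hence Banach's theorem applies (lemma
  \<open>semilinear_problem_solvable\<close>). The comparison principles keep the solution between \<open>x\<close> and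
  \<open>y\<^sub>\<infinity>\<close>, strictly on the side of \<open>y\<^sub>\<infinity>\<close> on which it starts.

  Monotonicity and limit. If \<open>y\<close> stays below \<open>y\<^sub>\<infinity>\<close>, then \<open>p\<close> exceeds its steady value \<open>\<delta> y\<^sub>\<infinity>\<close>, so
  \<open>y' \<ge> \<delta> (y\<^sub>\<infinity> - y) > 0\<close>; this yields strict growth and exponential convergence at once, and
  symmetrically above.\<close>

section \<open>Comparison principles on the half-line\<close>

lemma mono_half_line:
  fixes f :: "real \<Rightarrow> real"
  assumes d: "\<And>s. 0 \<le> s \<Longrightarrow> (f has_real_derivative f' s) (at s within {0..})"
    and nn: "\<And>s. 0 \<le> s \<Longrightarrow> 0 \<le> f' s"
    and "0 \<le> s" "s \<le> t"
  shows "f s \<le> f t"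
proof (rule DERIV_nonneg_imp_increasing_open[OF \<open>s \<le> t\<close>])
  fix u assume u: "s < u" "u < t"
  then have "at u within {0..} = at u"
    using \<open>0 \<le> s\<close> by (intro at_within_interior) simp
  then have "(f has_real_derivative f' u) (at u)"
    using d[of u] u \<open>0 \<le> s\<close> by (metis less_imp_le order_trans)
  then show "\<exists>y. (f has_real_derivative y) (at u) \<and> 0 \<le> y"
    using nn[of u] u \<open>0 \<le> s\<close> by auto
next
  have "continuous_on {0..} f"
    by (rule DERIV_continuous_on) (use d in auto)
  then show "continuous_on {s..t} f"
    by (rule continuous_on_subset) (use \<open>0 \<le> s\<close> in auto)
qed

lemma strict_mono_half_line:
  fixes f :: "real \<Rightarrow> real"
  assumes d: "\<And>s. 0 \<le> s \<Longrightarrow> (f has_real_derivative f' s) (at s within {0..})"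
    and pos: "\<And>s. 0 \<le> s \<Longrightarrow> 0 < f' s"
  shows "strict_mono_on {0..} f"
proof (rule strict_mono_onI)
  fix s t :: real assume st: "s \<in> {0..}" "t \<in> {0..}" "s < t"
  show "f s < f t"
  proof (rule DERIV_pos_imp_increasing_open[OF \<open>s < t\<close>])
    fix u assume u: "s < u" "u < t"
    then have "at u within {0..} = at u"
      using st by (intro at_within_interior) simp
    then have "(f has_real_derivative f' u) (at u)"
      using d[of u] u st by (metis atLeast_iff less_imp_le order_trans)
    then show "\<exists>y. (f has_real_derivative y) (at u) \<and> 0 < y"
      using pos[of u] u st by auto
  next
    have "continuous_on {0..} f"
      by (rule DERIV_continuous_on) (use d in auto)
    then show "continuous_on {s..t} f"
      by (rule continuous_on_subset) (use st in auto)
  qed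
qed

text \<open>The difference of the two functions, discounted by \<open>exp (- b s)\<close>, is nondecreasing and tends to
  \<open>0\<close>; so it is nowhere positive. Information travels from infinity to the left.\<close>

lemma backward_comparison:
  fixes q1 q2 g1 g2 :: "real \<Rightarrow> real"
  assumes q1: "\<And>s. 0 \<le> s \<Longrightarrow> (q1 has_real_derivative b * q1 s - g1 s) (at s within {0..})"
    and q2: "\<And>s. 0 \<le> s \<Longrightarrow> (q2 has_real_derivative b * q2 s - g2 s) (at s within {0..})"
    and l1: "((\<lambda>s. exp (- b * s) * q1 s) \<longlongrightarrow> 0) at_top"
    and l2: "((\<lambda>s. exp (- b * s) * q2 s) \<longlongrightarrow> 0) at_top"
    and le: "\<And>s. 0 \<le> s \<Longrightarrow> g1 s \<le> g2 s"
    and s: "0 \<le> s"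
  shows "q1 s \<le> q2 s"
proof -
  let ?f = "\<lambda>s. exp (- b * s) * q1 s - exp (- b * s) * q2 s"
  have d: "(?f has_real_derivative exp (- b * t) * (g2 t - g1 t)) (at t within {0..})"
    if "0 \<le> t" for t
    by (auto intro!: derivative_eq_intros q1[OF that] q2[OF that] simp: algebra_simps)
  have "?f s \<le> ?f t" if "s \<le> t" for t
    by (rule mono_half_line[OF d _ s that]) (use le in auto)
  then have "\<forall>\<^sub>F t in at_top. ?f s \<le> ?f t"
    using eventually_ge_at_top[of s] by (rule eventually_mono[rotated]) simp
  moreover have "(?f \<longlongrightarrow> 0) at_top"
    using tendsto_diff[OF l1 l2] by simp
  ultimately have "?f s \<le> 0"
    by (intro tendsto_lowerbound[of ?f 0 at_top]) auto
  then show ?thesis by simp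
qed

lemma forward_comparison:
  fixes w1 w2 q1 q2 :: "real \<Rightarrow> real"
  assumes w1: "\<And>s. 0 \<le> s \<Longrightarrow> (w1 has_real_derivative - a * w1 s + q1 s) (at s within {0..})"
    and w2: "\<And>s. 0 \<le> s \<Longrightarrow> (w2 has_real_derivative - a * w2 s + q2 s) (at s within {0..})"
    and init: "w1 0 \<le> w2 0"
    and le: "\<And>s. 0 \<le> s \<Longrightarrow> q1 s \<le> q2 s"
    and s: "0 \<le> s"
  shows "w1 s \<le> w2 s"
proof -
  let ?f = "\<lambda>s. exp (a * s) * (w2 s - w1 s)"
  have d: "(?f has_real_derivative exp (a * t) * (q2 t - q1 t)) (at t within {0..})"
    if "0 \<le> t" for t
    by (auto intro!: derivative_eq_intros w1[OF that] w2[OF that] simp: algebra_simps)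
  have "?f 0 \<le> ?f s"
    by (rule mono_half_line[OF d]) (use le s in auto)
  then have "0 \<le> ?f s" using init by simp
  then show ?thesis by (simp add: zero_le_mult_iff)
qed

lemma exp_neg_mult_tendsto_0:
  fixes b c :: real
  assumes "0 < b"
  shows "((\<lambda>s. exp (- b * s) * c) \<longlongrightarrow> 0) at_top"
proof -
  have "filterlim (\<lambda>s. - b * s) at_bot at_top"
    using assms by (intro filterlim_tendsto_neg_mult_at_bot[OF tendsto_const _ filterlim_ident]) simp
  then show ?thesis
    by (intro tendsto_mult_left_zero filterlim_compose[OF exp_at_bot])
qed

text \<open>Comparison with the stationary solution \<open>C / b\<close>.\<close>

lemma
  fixes q g :: "real \<Rightarrow> real"
  assumes b: "0 < b"
    and q: "\<And>s. 0 \<le> s \<Longrightarrow> (q has_real_derivative b * q s - g s) (at s within {0..})"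
    and l: "((\<lambda>s. exp (- b * s) * q s) \<longlongrightarrow> 0) at_top"
    and s: "0 \<le> s"
  shows backward_le_const: "(\<And>s. 0 \<le> s \<Longrightarrow> g s \<le> C) \<Longrightarrow> q s \<le> C / b"
    and backward_ge_const: "(\<And>s. 0 \<le> s \<Longrightarrow> C \<le> g s) \<Longrightarrow> C / b \<le> q s"
proof -
  have c: "((\<lambda>s. C / b) has_real_derivative b * (C / b) - C) (at s within {0..})" for s
    using b by (auto intro!: derivative_eq_intros)
  note l' = exp_neg_mult_tendsto_0[OF b, of "C / b"]
  show "q s \<le> C / b" if "\<And>s. 0 \<le> s \<Longrightarrow> g s \<le> C"
    by (rule backward_comparison[OF q c l l' that s])
  show "C / b \<le> q s" if "\<And>s. 0 \<le> s \<Longrightarrow> C \<le> g s"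
    by (rule backward_comparison[OF c q l' l that s])
qed

text \<open>The comparison function relaxes from \<open>w 0\<close> to the stationary value \<open>N\<close> at rate \<open>a\<close>. Keeping the
  exponential term serves three purposes below: strict separation from \<open>y\<^sub>\<infinity>\<close>, the lower bound
  \<open>exp (- \<delta> s) x\<close> (for \<open>N = 0\<close>), and convergence.\<close>

lemma
  fixes w q :: "real \<Rightarrow> real"
  assumes w: "\<And>s. 0 \<le> s \<Longrightarrow> (w has_real_derivative - a * w s + q s) (at s within {0..})"
    and s: "0 \<le> s"
  shows forward_le_relax:
      "(\<And>s. 0 \<le> s \<Longrightarrow> q s \<le> a * N) \<Longrightarrow> w s \<le> N + exp (- a * s) * (w 0 - N)"
    and forward_ge_relax:
      "(\<And>s. 0 \<le> s \<Longrightarrow> a * N \<le> q s) \<Longrightarrow> N + exp (- a * s) * (w 0 - N) \<le> w s"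
proof -
  let ?v = "\<lambda>s. N + exp (- a * s) * (w 0 - N)"
  have v: "(?v has_real_derivative - a * ?v s + a * N) (at s within {0..})" for s
    by (auto intro!: derivative_eq_intros simp: algebra_simps)
  show "w s \<le> ?v s" if "\<And>s. 0 \<le> s \<Longrightarrow> q s \<le> a * N"
    by (rule forward_comparison[OF w v _ that s]) simp_all
  show "?v s \<le> w s" if "\<And>s. 0 \<le> s \<Longrightarrow> a * N \<le> q s"
    by (rule forward_comparison[OF v w _ that s]) simp_all
qed

section \<open>Tail integrals and discounted equations\<close>

text \<open>The integrand is controlled only on \<open>{0..}\<close>, so the fundamental theorem of calculus is applied on
  the open half-line, where derivatives are two-sided; the endpoint is a null set.\<close>

lemma tail_integral_of_antiderivative:
  fixes f Q :: "real \<Rightarrow> real"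
  assumes d: "\<And>s. 0 \<le> s \<Longrightarrow> (Q has_real_derivative - f s) (at s within {0..})"
    and cont: "continuous_on {0..} f"
    and nn: "\<And>s. 0 \<le> s \<Longrightarrow> 0 \<le> f s"
    and lim: "(Q \<longlongrightarrow> 0) at_top"
    and s: "0 \<le> s"
  shows "set_integrable lborel {s..} f" and "(LINT u:{s..}|lborel. f u) = Q s"
proof -
  have int: "at u within {0..} = at u" if "s < u" for u
    using s that by (intro at_within_interior) simp
  have contQ: "continuous_on {0..} Q"
    by (rule DERIV_continuous_on) (use d in auto)
  have 1: "((\<lambda>u. - Q u) has_real_derivative f u) (at u)" if "s < u" for u
    using DERIV_minus[OF d[of u]] s that by (simp add: int)
  have 2: "isCont f u" if "s < u" for u
    by (rule continuous_on_interior[OF cont]) (use s that in simp)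
  have "(Q \<longlongrightarrow> Q s) (at s within {0..})"
    using contQ s by (simp add: continuous_on_def)
  then have "(Q \<longlongrightarrow> Q s) (at_right s)"
    by (rule tendsto_within_subset) (use s in auto)
  then have A: "(((\<lambda>u. - Q u) \<circ> real_of_ereal) \<longlongrightarrow> - Q s) (at_right (ereal s))"
    by (simp add: ereal_tendsto_simps1 tendsto_minus)
  have B: "(((\<lambda>u. - Q u) \<circ> real_of_ereal) \<longlongrightarrow> 0) (at_left \<infinity>)"
    using tendsto_minus[OF lim] by (simp add: ereal_tendsto_simps1)
  have nn': "AE u in lborel. ereal s < ereal u \<longrightarrow> ereal u < \<infinity> \<longrightarrow> 0 \<le> f u"
    using nn s by (intro AE_I2) auto
  have i: "set_integrable lborel (einterval (ereal s) \<infinity>) f"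
    by (rule interval_integral_FTC_nonneg(1)[OF _ _ _ nn' A B]) (use 1 2 in auto)
  have v: "(LBINT u=ereal s..\<infinity>. f u) = 0 - (- Q s)"
    by (rule interval_integral_FTC_nonneg(2)[OF _ _ _ nn' A B]) (use 1 2 in auto)
  have ein: "einterval (ereal s) \<infinity> = {s<..}"
    by (auto simp: einterval_def)
  have null: "AE u in lborel. u \<in> {s<..} \<longleftrightarrow> u \<in> {s..}"
    using AE_lborel_singleton[of s] by eventually_elim auto
  have split: "{s..} = {s} \<union> {s<..}" by auto
  have "set_integrable lborel {s} f"
    by (rule set_integrable_subset[of _ "{s..s}"], rule borel_integrable_atLeastAtMost') auto
  then show int': "set_integrable lborel {s..} f"
    unfolding split using i ein by (intro set_integrable_Un) auto
  have "(LINT u:{s..}|lborel. f u) = (LINT u:{s<..}|lborel. f u)"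
    using int' i ein null
    by (intro set_integral_cong_set) (auto simp: set_borel_measurable_def set_integrable_def)
  also have "\<dots> = Q s"
    using v ein by (simp add: interval_lebesgue_integral_def)
  finally show "(LINT u:{s..}|lborel. f u) = Q s" .
qed

lemma tail_integral_derivative:
  fixes f :: "real \<Rightarrow> real"
  assumes cont: "continuous_on {0..} f" and int: "set_integrable lborel {0..} f" and s: "0 \<le> s"
  shows "((\<lambda>s. LINT u:{s..}|lborel. f u) has_real_derivative - f s) (at s within {0..})"
    and "((\<lambda>s. LINT u:{s..}|lborel. f u) \<longlongrightarrow> 0) at_top"
proof -
  let ?I = "LINT u:{0..}|lborel. f u"
  have eq: "(LINT u:{t..}|lborel. f u) = ?I - (LINT u:{0..t}|lborel. f u)" if "0 \<le> t" for t
  proof -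
    have a: "set_integrable lborel {0..t} f"
      by (rule set_integrable_subset[OF int]) auto
    have b: "set_integrable lborel {t..} f"
      by (rule set_integrable_subset[OF int]) (use that in auto)
    have null: "AE u in lborel. u \<in> {t..} \<longleftrightarrow> u \<in> {t<..}"
      using AE_lborel_singleton[of t] by eventually_elim auto
    have c: "set_integrable lborel {t<..} f"
      by (rule set_integrable_subset[OF b]) auto
    have "?I = (LINT u:{0..t} \<union> {t<..}|lborel. f u)"
      using that by (intro arg_cong[where f="\<lambda>A. LINT u:A|lborel. f u"]) auto
    also have "\<dots> = (LINT u:{0..t}|lborel. f u) + (LINT u:{t<..}|lborel. f u)"
      by (rule set_integral_Un[OF _ a c]) auto
    also have "(LINT u:{t<..}|lborel. f u) = (LINT u:{t..}|lborel. f u)"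
      using b c null
      by (intro set_integral_cong_set) (auto simp: set_borel_measurable_def set_integrable_def)
    finally show ?thesis by simp
  qed
  have "((\<lambda>t. ?I - (LINT u:{0..t}|lborel. f u)) \<longlongrightarrow> ?I - ?I) at_top"
    by (intro tendsto_intros tendsto_set_lebesgue_integral_at_top int) auto
  then have "((\<lambda>t. ?I - (LINT u:{0..t}|lborel. f u)) \<longlongrightarrow> 0) at_top" by simp
  moreover have "\<forall>\<^sub>F t in at_top. ?I - (LINT u:{0..t}|lborel. f u) = (LINT u:{t..}|lborel. f u)"
    using eventually_ge_at_top[of 0] by eventually_elim (rule eq[symmetric])
  ultimately show "((\<lambda>s. LINT u:{s..}|lborel. f u) \<longlongrightarrow> 0) at_top"
    by (rule Lim_transform_eventually)
  have eq': "(LINT u:{t..}|lborel. f u) = ?I - integral {0..t} f" if "0 \<le> t" for t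
    using eq[OF that] set_borel_integral_eq_integral(2)[OF set_integrable_subset[OF int, of "{0..t}"]]
    by auto
  have "((\<lambda>t. integral {0..t} f) has_real_derivative f s) (at s within {0..s+1})"
    by (rule integral_has_real_derivative[OF continuous_on_subset[OF cont]]) (use s in auto)
  moreover have "at s within {0..s+1} = at s within {0..}"
    by (rule at_within_nhd[of s "{s-1<..<s+1}"]) auto
  ultimately have "((\<lambda>t. integral {0..t} f) has_real_derivative f s) (at s within {0..})"
    by simp
  then have "((\<lambda>t. ?I - integral {0..t} f) has_real_derivative - f s) (at s within {0..})"
    by (auto intro!: derivative_eq_intros)
  then show "((\<lambda>s. LINT u:{s..}|lborel. f u) has_real_derivative - f s) (at s within {0..})"
    by (rule has_field_derivative_transform_within[of _ _ _ _ 1]) (simp_all add: s flip: eq')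
qed

lemma shifted_kernel:
  fixes b s :: real
  shows "(\<lambda>u. exp (- b * (u - s)) * g u) = (\<lambda>u. exp (b * s) * (exp (- b * u) * g u))"
  by (auto simp: algebra_simps simp flip: exp_add)

text \<open>The next two lemmas identify the improper integral in the equations with the solution of
  \<open>q' = b q - g\<close> that decays after discounting. Nonnegativity of \<open>g\<close> in the second one makes
  convergence of the improper integral equivalent to Lebesgue integrability.\<close>

lemma discounted_tail_solves:
  fixes b :: real and g :: "real \<Rightarrow> real"
  assumes cont: "continuous_on {0..} g"
    and int: "set_integrable lborel {0..} (\<lambda>u. exp (- b * u) * g u)"
  defines "q \<equiv> \<lambda>s. LINT u:{s..}|lborel. exp (- b * (u - s)) * g u"
  shows "\<And>s. 0 \<le> s \<Longrightarrow> (q has_real_derivative b * q s - g s) (at s within {0..})"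
    and "((\<lambda>s. exp (- b * s) * q s) \<longlongrightarrow> 0) at_top"
proof -
  let ?f = "\<lambda>u. exp (- b * u) * g u"
  define Q where "Q = (\<lambda>s. LINT u:{s..}|lborel. ?f u)"
  have contf: "continuous_on {0..} ?f"
    by (intro continuous_intros cont)
  have q_eq: "q s = exp (b * s) * Q s" for s
    unfolding q_def Q_def shifted_kernel by simp
  have Q: "(Q has_real_derivative - ?f s) (at s within {0..})" if "0 \<le> s" for s
    unfolding Q_def by (rule tail_integral_derivative(1)[OF contf int that])
  have "(Q \<longlongrightarrow> 0) at_top"
    unfolding Q_def by (rule tail_integral_derivative(2)[OF contf int order_refl])
  then show "((\<lambda>s. exp (- b * s) * q s) \<longlongrightarrow> 0) at_top"
    by (simp add: q_eq flip: mult.assoc exp_add)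
  show "(q has_real_derivative b * q s - g s) (at s within {0..})" if "0 \<le> s" for s
    unfolding q_eq[abs_def]
    by (auto intro!: derivative_eq_intros Q[OF that] simp: exp_minus)
qed

lemma discounted_tail_unique:
  fixes b :: real and g q :: "real \<Rightarrow> real"
  assumes q: "\<And>s. 0 \<le> s \<Longrightarrow> (q has_real_derivative b * q s - g s) (at s within {0..})"
    and lim: "((\<lambda>s. exp (- b * s) * q s) \<longlongrightarrow> 0) at_top"
    and cont: "continuous_on {0..} g" and nn: "\<And>s. 0 \<le> s \<Longrightarrow> 0 \<le> g s" and s: "0 \<le> s"
  shows "set_integrable lborel {s..} (\<lambda>u. exp (- b * (u - s)) * g u)"
    and "(LINT u:{s..}|lborel. exp (- b * (u - s)) * g u) = q s"
proof -
  have d: "((\<lambda>s. exp (- b * s) * q s) has_real_derivative - (exp (- b * t) * g t)) (at t within {0..})"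
    if "0 \<le> t" for t
    by (auto intro!: derivative_eq_intros q[OF that] simp: algebra_simps)
  have c: "continuous_on {0..} (\<lambda>u. exp (- b * u) * g u)"
    by (intro continuous_intros cont)
  note tail = tail_integral_of_antiderivative[OF d c _ lim s]
  have "set_integrable lborel {s..} (\<lambda>u. exp (- b * u) * g u)"
    by (rule tail(1)) (simp_all add: nn)
  then show "set_integrable lborel {s..} (\<lambda>u. exp (- b * (u - s)) * g u)"
    unfolding shifted_kernel by simp
  have "(LINT u:{s..}|lborel. exp (- b * u) * g u) = exp (- b * s) * q s"
    by (rule tail(2)) (simp_all add: nn)
  then show "(LINT u:{s..}|lborel. exp (- b * (u - s)) * g u) = q s"
    unfolding shifted_kernel set_integral_mult_right by (simp flip: mult.assoc exp_add)
qed

section \<open>A two-point boundary value problem on the half-line\<close>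

text \<open>The factorised form of \<open>- w'' + (b - a) w' + a b w = g\<close> with the value at \<open>0\<close> and a growth
  restriction at infinity as boundary conditions. The source \<open>g\<close> is a separate argument: nonlinear
  problems are expressed by letting it depend on \<open>w\<close>.\<close>

definition solves_linear ::
  "real \<Rightarrow> real \<Rightarrow> real \<Rightarrow> (real \<Rightarrow> real) \<Rightarrow> (real \<Rightarrow> real) \<Rightarrow> (real \<Rightarrow> real) \<Rightarrow> bool" where
  "solves_linear a b w0 g w q \<longleftrightarrow> w 0 = w0 \<and>
    (\<forall>s\<ge>0. (w has_real_derivative - a * w s + q s) (at s within {0..})) \<and>
    (\<forall>s\<ge>0. (q has_real_derivative b * q s - g s) (at s within {0..})) \<and>
    ((\<lambda>s. exp (- b * s) * q s) \<longlongrightarrow> 0) at_top"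

lemma linear_problem_solvable:
  fixes a b w0 C :: real and g :: "real \<Rightarrow> real"
  assumes b: "0 < b" and cont: "continuous_on {0..} g" and bound: "\<And>s. 0 \<le> s \<Longrightarrow> \<bar>g s\<bar> \<le> C"
  shows "\<exists>w q. solves_linear a b w0 g w q"
proof -
  let ?f = "\<lambda>u. exp (- b * u) * g u"
  have contf: "continuous_on {0..} ?f"
    by (intro continuous_intros cont)
  have "set_integrable lborel {0..} (\<lambda>u. exp (- b * u))"
  proof (rule tail_integral_of_antiderivative(1)[where Q = "\<lambda>s. exp (- b * s) * (1 / b)"])
    show "((\<lambda>s. exp (- b * s) * (1 / b)) has_real_derivative - exp (- b * s)) (at s within {0..})" for s
      using b by (auto intro!: derivative_eq_intros)
    show "((\<lambda>s. exp (- b * s) * (1 / b)) \<longlongrightarrow> 0) at_top"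
      by (rule exp_neg_mult_tendsto_0[OF b])
    show "continuous_on {0..} (\<lambda>u. exp (- b * u))"
      by (intro continuous_intros)
  qed simp_all
  then have "set_integrable lborel {0..} (\<lambda>u. C * exp (- b * u))"
    by (rule set_integrable_mult_right)
  moreover have "set_borel_measurable lborel {0..} ?f"
    using borel_measurable_continuous_on_indicator[OF _ contf]
    by (simp add: set_borel_measurable_def)
  moreover have "AE u in lborel. u \<in> {0..} \<longrightarrow> norm (?f u) \<le> norm (C * exp (- b * u))"
  proof (intro AE_I2 impI)
    fix u :: real assume "u \<in> {0..}"
    then have "\<bar>g u\<bar> \<le> \<bar>C\<bar>" using bound[of u] by simp
    then have "exp (- b * u) * \<bar>g u\<bar> \<le> exp (- b * u) * \<bar>C\<bar>"
      by (intro mult_left_mono) auto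
    then show "norm (?f u) \<le> norm (C * exp (- b * u))"
      unfolding real_norm_def abs_mult abs_exp_cancel by (metis mult.commute)
  qed
  ultimately have int: "set_integrable lborel {0..} ?f"
    by (rule set_integrable_bound)
  define q where "q = (\<lambda>s. LINT u:{s..}|lborel. exp (- b * (u - s)) * g u)"
  have q: "(q has_real_derivative b * q s - g s) (at s within {0..})" if "0 \<le> s" for s
    unfolding q_def by (rule discounted_tail_solves(1)[OF cont int that])
  have lim: "((\<lambda>s. exp (- b * s) * q s) \<longlongrightarrow> 0) at_top"
    unfolding q_def by (rule discounted_tail_solves(2)[OF cont int])
  have contq: "continuous_on {0..} q"
    by (rule DERIV_continuous_on) (use q in auto)
  define J where "J = (\<lambda>s. integral {0..s} (\<lambda>r. exp (a * r) * q r))"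
  have J: "(J has_real_derivative exp (a * s) * q s) (at s within {0..})" if "0 \<le> s" for s
  proof -
    have "(J has_real_derivative exp (a * s) * q s) (at s within {0..s+1})"
      unfolding J_def
    proof (rule integral_has_real_derivative[where t = s])
      have "continuous_on {0..s+1} q"
        by (rule continuous_on_subset[OF contq]) auto
      then show "continuous_on {0..s+1} (\<lambda>r. exp (a * r) * q r)"
        by (intro continuous_intros)
      show "s \<in> {0..s+1}" using that by simp
    qed
    moreover have "at s within {0..s+1} = at s within {0..}"
      by (rule at_within_nhd[of s "{s-1<..<s+1}"]) auto
    ultimately show ?thesis by simp
  qed
  define w where "w = (\<lambda>s. exp (- a * s) * (w0 + J s))"
  have w: "(w has_real_derivative - a * w s + q s) (at s within {0..})" if "0 \<le> s" for s
    unfolding w_def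
    by (auto intro!: derivative_eq_intros J[OF that] simp: algebra_simps simp flip: exp_add)
  have "w 0 = w0" by (simp add: w_def J_def)
  then show ?thesis
    using w q lim unfolding solves_linear_def by (intro exI[of _ w] exI[of _ q]) simp
qed

text \<open>A constant source \<open>c\<close> produces the stationary response \<open>c / (a b)\<close>, and the problem is monotone in
  its source. This is the norm bound on the solution operator behind the contraction.\<close>

lemma solves_linear_perturbation:
  assumes a: "0 < a" and b: "0 < b"
    and 1: "solves_linear a b w0 g1 w1 q1" and 2: "solves_linear a b w0 g2 w2 q2"
    and le: "\<And>s. 0 \<le> s \<Longrightarrow> g1 s \<le> g2 s + c" and c: "0 \<le> c" and s: "0 \<le> s"
  shows "w1 s \<le> w2 s + c / (a * b)"
proof -
  have q: "q1 t \<le> q2 t + c / b" if "0 \<le> t" for t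
  proof (rule backward_comparison[OF _ _ _ _ le that])
    show "(q1 has_real_derivative b * q1 s - g1 s) (at s within {0..})" if "0 \<le> s" for s
      using 1 that by (simp add: solves_linear_def)
    show "((\<lambda>s. q2 s + c / b) has_real_derivative b * (q2 s + c / b) - (g2 s + c)) (at s within {0..})"
      if "0 \<le> s" for s
      using 2 that b by (auto intro!: derivative_eq_intros simp: solves_linear_def algebra_simps)
    show "((\<lambda>s. exp (- b * s) * q1 s) \<longlongrightarrow> 0) at_top"
      using 1 by (simp add: solves_linear_def)
    have "((\<lambda>s. exp (- b * s) * q2 s + exp (- b * s) * (c / b)) \<longlongrightarrow> 0 + 0) at_top"
      by (rule tendsto_add[OF _ exp_neg_mult_tendsto_0[OF b]]) (use 2 in \<open>simp add: solves_linear_def\<close>)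
    then show "((\<lambda>s. exp (- b * s) * (q2 s + c / b)) \<longlongrightarrow> 0) at_top"
      by (simp add: distrib_left)
  qed
  show ?thesis
  proof (rule forward_comparison[OF _ _ _ q s])
    show "(w1 has_real_derivative - a * w1 s + q1 s) (at s within {0..})" if "0 \<le> s" for s
      using 1 that by (simp add: solves_linear_def)
    show "((\<lambda>s. w2 s + c / (a * b)) has_real_derivative
        - a * (w2 s + c / (a * b)) + (q2 s + c / b)) (at s within {0..})" if "0 \<le> s" for s
      using 2 that a b
      by (auto intro!: derivative_eq_intros simp: solves_linear_def algebra_simps)
    show "w1 0 \<le> w2 0 + c / (a * b)"
      using 1 2 a b c by (simp add: solves_linear_def)
  qed
qed

lemma solves_linear_bounded:
  assumes a: "0 < a" and b: "0 < b" and sol: "solves_linear a b w0 g w q"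
    and bound: "\<And>s. 0 \<le> s \<Longrightarrow> \<bar>g s\<bar> \<le> C" and s: "0 \<le> s"
  shows "\<bar>w s\<bar> \<le> \<bar>w0\<bar> + C / (a * b)"
proof -
  have C: "0 \<le> C" using bound[of 0] by simp
  have q: "(q has_real_derivative b * q s - g s) (at s within {0..})"
    and w: "(w has_real_derivative - a * w s + q s) (at s within {0..})" if "0 \<le> s" for s
    using sol that by (simp_all add: solves_linear_def)
  have lim: "((\<lambda>s. exp (- b * s) * q s) \<longlongrightarrow> 0) at_top" and w0: "w 0 = w0"
    using sol by (simp_all add: solves_linear_def)
  define N where "N = \<bar>w0\<bar> + C / (a * b)"
  have N: "C / b \<le> a * N" "\<bar>w0\<bar> \<le> N"
    using a b C by (auto simp: N_def field_simps)
  have "g s \<le> C" "- C \<le> g s" if "0 \<le> s" for s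
    using bound[OF that] by auto
  then have "q t \<le> C / b" "(- C) / b \<le> q t" if "0 \<le> t" for t
    using backward_le_const[OF b q lim that, of C] backward_ge_const[OF b q lim that, of "- C"]
    by auto
  then have qN: "q t \<le> a * N" "a * (- N) \<le> q t" if "0 \<le> t" for t
    using N(1) that by (force intro: order_trans)+
  have "w s \<le> N + exp (- a * s) * (w 0 - N)"
    by (rule forward_le_relax[OF w s qN(1)])
  moreover have "exp (- a * s) * (w 0 - N) \<le> 0"
    using N(2) w0 by (simp add: mult_le_0_iff)
  moreover have "- N + exp (- a * s) * (w 0 - (- N)) \<le> w s"
    by (rule forward_ge_relax[OF w s qN(2)])
  moreover have "0 \<le> exp (- a * s) * (w 0 - (- N))"
    using N(2) w0 by (simp add: zero_le_mult_iff)
  ultimately show ?thesis by (simp add: N_def[symmetric])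
qed

text \<open>Banach's fixed point theorem in the space of bounded continuous functions: \<open>w \<mapsto> H \<circ> w\<close> has
  Lipschitz constant \<open>k\<close> and the linear solution operator has norm \<open>1 / (a b)\<close>.\<close>

lemma semilinear_problem_solvable:
  fixes H :: "real \<Rightarrow> real"
  assumes a: "0 < a" and b: "0 < b" and k: "0 \<le> k" "k < a * b"
    and lip: "\<And>u v. \<bar>H u - H v\<bar> \<le> k * \<bar>u - v\<bar>" and bound: "\<And>u. \<bar>H u\<bar> \<le> C"
  shows "\<exists>w q. solves_linear a b w0 (\<lambda>s. H (w s)) w q"
proof -
  have contH: "continuous_on UNIV H"
    by (rule lipschitz_on_continuous_on[of k], rule lipschitz_onI)
      (use lip k in \<open>auto simp: dist_real_def\<close>)
  have contHf: "continuous_on {0..} (\<lambda>s. H (apply_bcontfun f s))" for f :: "real \<Rightarrow>\<^sub>C real"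
    by (rule continuous_on_compose2[OF contH]) auto
  have "\<forall>f::real \<Rightarrow>\<^sub>C real. \<exists>wq. solves_linear a b w0 (\<lambda>s. H (f s)) (fst wq) (snd wq)"
  proof
    fix f :: "real \<Rightarrow>\<^sub>C real"
    show "\<exists>wq. solves_linear a b w0 (\<lambda>s. H (f s)) (fst wq) (snd wq)"
      using linear_problem_solvable[OF b contHf bound]
      by fastforce
  qed
  from choice[OF this] obtain S
    where S: "solves_linear a b w0 (\<lambda>s. H (f s)) (fst (S f)) (snd (S f))"
    for f :: "real \<Rightarrow>\<^sub>C real" by blast
  \<comment> \<open>The fixed point lives in functions on the whole line, so solutions are extended to the left of
    \<open>0\<close> by their initial value.\<close>
  define T where "T = (\<lambda>f. Bcontfun (\<lambda>s. fst (S f) (max 0 s)))"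
  have mem: "(\<lambda>s. fst (S f) (max 0 s)) \<in> bcontfun" for f
  proof (rule bcontfun_normI)
    have "continuous_on {0..} (fst (S f))"
      by (rule DERIV_continuous_on) (use S[of f] in \<open>auto simp: solves_linear_def\<close>)
    then show "continuous_on UNIV (\<lambda>s. fst (S f) (max 0 s))"
      by (rule continuous_on_compose2) (auto intro!: continuous_intros)
    show "norm (fst (S f) (max 0 s)) \<le> \<bar>w0\<bar> + C / (a * b)" for s
      using solves_linear_bounded[OF a b S bound, of "max 0 s" f] by simp
  qed
  have T: "apply_bcontfun (T f) s = fst (S f) (max 0 s)" for f s
    by (simp add: T_def Bcontfun_inverse[OF mem])
  have le: "fst (S f) s \<le> fst (S h) s + k * dist f h / (a * b)" if "0 \<le> s" for f h s
  proof (rule solves_linear_perturbation[OF a b S S _ _ that])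
    show "H (f s) \<le> H (h s) + k * dist f h" for s
      using lip[of "f s" "h s"] mult_left_mono[OF dist_bounded[of f s h] k(1)]
      by (simp add: dist_real_def)
  qed (use k in simp)
  have "\<exists>!f. T f = f"
  proof (rule banach_fix_type[of "k / (a * b)"])
    show "0 \<le> k / (a * b)" "k / (a * b) < 1"
      using a b k by simp_all
    show "\<forall>f h. dist (T f) (T h) \<le> k / (a * b) * dist f h"
    proof (intro allI dist_bound)
      fix f h :: "real \<Rightarrow>\<^sub>C real" and s :: real
      show "dist (T f s) (T h s) \<le> k / (a * b) * dist f h"
        using le[of "max 0 s" f h] le[of "max 0 s" h f]
        by (simp add: T dist_real_def abs_le_iff dist_commute)
    qed
  qed
  then obtain f where f: "T f = f" by blast
  have "f s = fst (S f) s" if "0 \<le> s" for s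
    using T[of f s] that by (simp add: f)
  then have "solves_linear a b w0 (\<lambda>s. H (fst (S f) s)) (fst (S f)) (snd (S f))"
    using S[of f] by (simp add: solves_linear_def)
  then show ?thesis by blast
qed

section \<open>Both equations as one planar system\<close>

lemma y_solution_iff_solves_linear:
  "y_solution \<delta> \<rho> \<beta> x y \<longleftrightarrow>
    (\<forall>s\<ge>0. 0 < y s) \<and> (\<exists>p. solves_linear \<delta> (\<rho> + \<delta>) x (\<lambda>s. y s powr (- \<beta>)) y p)"
proof (intro iffI conjI)
  assume sol: "y_solution \<delta> \<rho> \<beta> x y"
  then show pos: "\<forall>s\<ge>0. 0 < y s" by (simp add: y_solution_def)
  define p where "p = (\<lambda>s. LINT u:{s..}|lborel. exp (- (\<rho> + \<delta>) * (u - s)) * y u powr (- \<beta>))"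
  have y: "(y has_real_derivative - \<delta> * y s + p s) (at s within {0..})" if "0 \<le> s" for s
    using sol that by (simp add: y_solution_def p_def)
  have conty: "continuous_on {0..} y"
    by (rule DERIV_continuous_on) (use y in auto)
  have cont: "continuous_on {0..} (\<lambda>s. y s powr (- \<beta>))"
    by (rule continuous_on_powr) (use conty pos in \<open>auto simp: less_imp_neq[symmetric]\<close>)
  have "set_integrable lborel {0..} (\<lambda>u. exp (- (\<rho> + \<delta>) * (u - 0)) * y u powr (- \<beta>))"
    using sol unfolding y_solution_def by blast
  then have int: "set_integrable lborel {0..} (\<lambda>u. exp (- (\<rho> + \<delta>) * u) * y u powr (- \<beta>))"
    by simp
  have "solves_linear \<delta> (\<rho> + \<delta>) x (\<lambda>s. y s powr (- \<beta>)) y p"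
    unfolding solves_linear_def p_def
    using discounted_tail_solves[OF cont int] y sol by (simp add: p_def y_solution_def)
  then show "\<exists>p. solves_linear \<delta> (\<rho> + \<delta>) x (\<lambda>s. y s powr (- \<beta>)) y p" by blast
next
  assume "(\<forall>s\<ge>0. 0 < y s) \<and> (\<exists>p. solves_linear \<delta> (\<rho> + \<delta>) x (\<lambda>s. y s powr (- \<beta>)) y p)"
  then obtain p where pos: "\<And>s. 0 \<le> s \<Longrightarrow> 0 < y s"
    and p: "solves_linear \<delta> (\<rho> + \<delta>) x (\<lambda>s. y s powr (- \<beta>)) y p" by blast
  have dy: "(y has_real_derivative - \<delta> * y s + p s) (at s within {0..})"
    and dp: "(p has_real_derivative (\<rho> + \<delta>) * p s - y s powr (- \<beta>)) (at s within {0..})"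
    if "0 \<le> s" for s
    using p that by (simp_all add: solves_linear_def)
  have conty: "continuous_on {0..} y"
    by (rule DERIV_continuous_on) (use dy in auto)
  have contp: "continuous_on {0..} p"
    by (rule DERIV_continuous_on) (use dp in auto)
  have cont: "continuous_on {0..} (\<lambda>s. y s powr (- \<beta>))"
    by (rule continuous_on_powr) (use conty pos in \<open>auto simp: less_imp_neq[symmetric]\<close>)
  have lim: "((\<lambda>s. exp (- (\<rho> + \<delta>) * s) * p s) \<longlongrightarrow> 0) at_top"
    using p by (simp add: solves_linear_def)
  note tail = discounted_tail_unique[OF dp lim cont]
  have "Ck_on 1 {0..} y"
    unfolding One_nat_def Ck_on.simps
    using dy by (intro exI[of _ "\<lambda>s. - \<delta> * y s + p s"]) (auto intro!: continuous_intros conty contp)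
  then show "y_solution \<delta> \<rho> \<beta> x y"
    unfolding y_solution_def using pos p tail dy by (simp add: solves_linear_def)
qed

lemma z_y_integrand:
  fixes z :: real
  shows "exp (- (\<rho> + \<delta>) * (u - s)) * (exp (- \<delta> * u) * z) powr (- \<beta>) =
    exp ((\<rho> + \<delta>) * s) * (exp (- (\<rho> + \<delta> - \<delta> * \<beta>) * u) * z powr (- \<beta>))"
proof -
  have "(exp (- \<delta> * u) * z) powr (- \<beta>) = exp (\<delta> * \<beta> * u) * z powr (- \<beta>)"
    by (simp add: powr_mult exp_powr_real algebra_simps)
  moreover have "exp (- (\<rho> + \<delta>) * (u - s)) * exp (\<delta> * \<beta> * u) =
      exp ((\<rho> + \<delta>) * s) * exp (- (\<rho> + \<delta> - \<delta> * \<beta>) * u)"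
    by (simp add: algebra_simps flip: exp_add)
  ultimately show ?thesis by (metis mult.assoc)
qed

text \<open>Both directions are needed: solutions \<open>z\<close> are built from solutions \<open>y\<close>, and uniqueness for \<open>z\<close> is
  inherited from uniqueness for \<open>y\<close>.\<close>

lemma z_solution_iff_y_solution:
  "z_solution \<delta> \<rho> \<beta> x z \<longleftrightarrow> y_solution \<delta> \<rho> \<beta> x (\<lambda>s. exp (- \<delta> * s) * z s)"
    (is "_ \<longleftrightarrow> y_solution _ _ _ _ ?y")
proof -
  let ?h = "\<lambda>u. exp (- (\<rho> + \<delta> - \<delta> * \<beta>) * u) * z u powr (- \<beta>)"
  let ?k = "\<lambda>s u. exp (- (\<rho> + \<delta>) * (u - s)) * ?y u powr (- \<beta>)"
  have C1: "Ck_on 1 {0..} ?y \<longleftrightarrow> Ck_on 1 {0..} z"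
  proof
    assume "Ck_on 1 {0..} z"
    then obtain z' where z': "\<And>s. 0 \<le> s \<Longrightarrow> (z has_real_derivative z' s) (at s within {0..})"
      and cont: "continuous_on {0..} z'"
      by auto
    have "continuous_on {0..} z" by (rule DERIV_continuous_on) (use z' in auto)
    moreover have "(?y has_real_derivative exp (- \<delta> * s) * (z' s - \<delta> * z s)) (at s within {0..})"
      if "0 \<le> s" for s
      by (auto intro!: derivative_eq_intros z'[OF that] simp: algebra_simps)
    ultimately show "Ck_on 1 {0..} ?y"
      using cont unfolding One_nat_def Ck_on.simps
      by (intro exI[of _ "\<lambda>s. exp (- \<delta> * s) * (z' s - \<delta> * z s)"]) (auto intro!: continuous_intros)
  next
    assume "Ck_on 1 {0..} ?y"
    then obtain y' where y': "\<And>s. 0 \<le> s \<Longrightarrow> (?y has_real_derivative y' s) (at s within {0..})"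
      and cont: "continuous_on {0..} y'"
      by auto
    have y: "continuous_on {0..} ?y" by (rule DERIV_continuous_on) (use y' in auto)
    have "((\<lambda>s. exp (\<delta> * s) * ?y s) has_real_derivative exp (\<delta> * s) * (y' s + \<delta> * ?y s))
        (at s within {0..})" if "0 \<le> s" for s
    proof -
      have "((\<lambda>s. exp (\<delta> * s)) has_real_derivative exp (\<delta> * s) * \<delta>) (at s within {0..})"
        by (auto intro!: derivative_eq_intros)
      then show ?thesis
        by (rule DERIV_cong[OF DERIV_mult[OF _ y'[OF that]]]) (simp add: algebra_simps)
    qed
    moreover have "(\<lambda>s. exp (\<delta> * s) * ?y s) = z"
      by (auto simp: exp_minus)
    ultimately show "Ck_on 1 {0..} z"
      using cont y unfolding One_nat_def Ck_on.simps
      by (intro exI[of _ "\<lambda>s. exp (\<delta> * s) * (y' s + \<delta> * ?y s)"]) (auto intro!: continuous_intros)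
  qed
  have der: "(?y has_real_derivative - \<delta> * ?y s + exp ((\<rho> + \<delta>) * s) * I) (at s within {0..}) \<longleftrightarrow>
      (z has_real_derivative exp ((\<rho> + 2 * \<delta>) * s) * I) (at s within {0..})" for s I
  proof
    assume z: "(z has_real_derivative exp ((\<rho> + 2 * \<delta>) * s) * I) (at s within {0..})"
    have e: "exp ((\<rho> + \<delta>) * s) = exp (- \<delta> * s) * exp ((\<rho> + 2 * \<delta>) * s)"
      by (simp add: algebra_simps flip: exp_add)
    have "((\<lambda>s. exp (- \<delta> * s)) has_real_derivative exp (- \<delta> * s) * - \<delta>) (at s within {0..})"
      by (auto intro!: derivative_eq_intros)
    then show "(?y has_real_derivative - \<delta> * ?y s + exp ((\<rho> + \<delta>) * s) * I) (at s within {0..})"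
      by (rule DERIV_cong[OF DERIV_mult[OF _ z]]) (simp add: e)
  next
    assume y: "(?y has_real_derivative - \<delta> * ?y s + exp ((\<rho> + \<delta>) * s) * I) (at s within {0..})"
    have e: "exp ((\<rho> + 2 * \<delta>) * s) = exp (\<delta> * s) * exp ((\<rho> + \<delta>) * s)"
      by (simp add: algebra_simps flip: exp_add)
    have "((\<lambda>s. exp (\<delta> * s)) has_real_derivative exp (\<delta> * s) * \<delta>) (at s within {0..})"
      by (auto intro!: derivative_eq_intros)
    then have "((\<lambda>s. exp (\<delta> * s) * ?y s) has_real_derivative exp ((\<rho> + 2 * \<delta>) * s) * I)
        (at s within {0..})"
      by (rule DERIV_cong[OF DERIV_mult[OF _ y]]) (simp add: e, simp add: algebra_simps)
    moreover have "(\<lambda>s. exp (\<delta> * s) * ?y s) = z"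
      by (auto simp: exp_minus)
    ultimately show "(z has_real_derivative exp ((\<rho> + 2 * \<delta>) * s) * I) (at s within {0..})"
      by simp
  qed
  have pos: "(\<forall>s\<ge>0. 0 < ?y s) \<longleftrightarrow> (\<forall>s\<ge>0. 0 < z s)"
    by (simp add: zero_less_mult_iff)
  have eq: "?k s = (\<lambda>u. exp ((\<rho> + \<delta>) * s) * ?h u)" for s
    by (rule ext) (rule z_y_integrand)
  show ?thesis
    unfolding z_solution_def y_solution_def C1 pos eq set_integral_mult_right der by simp
qed

section \<open>Uniqueness\<close>

text \<open>Write \<open>W\<close>, \<open>Q\<close> for the differences of \<open>w\<close>, \<open>q\<close> after multiplication by \<open>exp (a s)\<close>, \<open>exp (- b s)\<close>. Then
  \<open>W'\<close> has the sign of \<open>Q\<close>, and \<open>Q'\<close> has the sign of \<open>W\<close> since \<open>h\<close> decreases. So \<open>W Q\<close> is nondecreasing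
  from the value \<open>0\<close>; being nonnegative, it makes \<open>Q\<^sup>2\<close> nondecreasing as well, and \<open>Q\<close> tends to \<open>0\<close>.\<close>

lemma decreasing_feedback_unique:
  fixes h :: "real \<Rightarrow> real"
  assumes 1: "solves_linear a b w0 (\<lambda>s. h (w1 s)) w1 q1"
    and 2: "solves_linear a b w0 (\<lambda>s. h (w2 s)) w2 q2"
    and dec: "antimono_on A h" and A: "\<And>s. 0 \<le> s \<Longrightarrow> w1 s \<in> A" "\<And>s. 0 \<le> s \<Longrightarrow> w2 s \<in> A"
    and s: "0 \<le> s"
  shows "w1 s = w2 s"
proof -
  define g where "g = (\<lambda>s. h (w1 s) - h (w2 s))"
  have w1: "(w1 has_real_derivative - a * w1 s + q1 s) (at s within {0..})"
    and w2: "(w2 has_real_derivative - a * w2 s + q2 s) (at s within {0..})"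
    and q1: "(q1 has_real_derivative b * q1 s - h (w1 s)) (at s within {0..})"
    and q2: "(q2 has_real_derivative b * q2 s - h (w2 s)) (at s within {0..})" if "0 \<le> s" for s
    using 1 2 that by (simp_all add: solves_linear_def)
  have init: "w1 0 = w2 0"
    using 1 2 by (simp add: solves_linear_def)
  have sgn: "(w1 t - w2 t) * g t \<le> 0" if "0 \<le> t" for t
    using A[OF that] dec unfolding monotone_on_def g_def mult_le_0_iff
    by (cases "w1 t \<le> w2 t") auto
  \<comment> \<open>\<open>?P\<close> is \<open>W Q\<close> and \<open>?R\<close> below is \<open>Q\<^sup>2\<close>.\<close>
  let ?P = "\<lambda>s. exp ((a - b) * s) * ((w1 s - w2 s) * (q1 s - q2 s))"
  have dP: "(?P has_real_derivative
      exp ((a - b) * t) * ((q1 t - q2 t)\<^sup>2 - (w1 t - w2 t) * g t)) (at t within {0..})"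
    if "0 \<le> t" for t
    by (auto intro!: derivative_eq_intros w1[OF that] w2[OF that] q1[OF that] q2[OF that]
        simp: g_def algebra_simps power2_eq_square)
  have same: "0 \<le> (w1 t - w2 t) * (q1 t - q2 t)" if "0 \<le> t" for t
  proof -
    have "?P 0 \<le> ?P t"
    proof (rule mono_half_line[OF dP _ order_refl that])
      show "0 \<le> exp ((a - b) * s) * ((q1 s - q2 s)\<^sup>2 - (w1 s - w2 s) * g s)" if "0 \<le> s" for s
        using sgn[OF that] by (intro mult_nonneg_nonneg) (auto intro: order_trans)
    qed
    then show ?thesis using init by (simp add: zero_le_mult_iff)
  qed
  let ?R = "\<lambda>s. (exp (- b * s) * (q1 s - q2 s))\<^sup>2"
  have dR: "(?R has_real_derivative
      2 * (exp (- b * t))\<^sup>2 * - ((q1 t - q2 t) * g t)) (at t within {0..})" if "0 \<le> t" for t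
    by (auto intro!: derivative_eq_intros q1[OF that] q2[OF that]
        simp: g_def algebra_simps power2_eq_square)
  have opp: "(q1 t - q2 t) * g t \<le> 0" if "0 \<le> t" for t
  proof -
    have "w1 t = w2 t \<Longrightarrow> g t = 0" by (simp add: g_def)
    then show ?thesis
      using same[OF that] sgn[OF that]
      by (cases "w1 t" "w2 t" rule: linorder_cases)
        (auto simp: zero_le_mult_iff mult_le_0_iff)
  qed
  have mono: "?R t \<le> ?R r" if "0 \<le> t" "t \<le> r" for t r
  proof (rule mono_half_line[OF dR _ that])
    show "0 \<le> 2 * (exp (- b * s))\<^sup>2 * - ((q1 s - q2 s) * g s)" if "0 \<le> s" for s
      using opp[OF that] by (intro mult_nonneg_nonneg) simp_all
  qed
  have "((\<lambda>s. exp (- b * s) * q1 s - exp (- b * s) * q2 s) \<longlongrightarrow> 0 - 0) at_top"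
    by (rule tendsto_diff) (use 1 2 in \<open>simp_all add: solves_linear_def\<close>)
  then have "((\<lambda>s. exp (- b * s) * (q1 s - q2 s)) \<longlongrightarrow> 0) at_top"
    by (simp add: right_diff_distrib)
  from tendsto_power[OF this, of 2] have lim: "(?R \<longlongrightarrow> 0) at_top"
    by simp
  have "?R t \<le> 0" if "0 \<le> t" for t
  proof (rule tendsto_lowerbound[OF lim])
    show "\<forall>\<^sub>F r in at_top. ?R t \<le> ?R r"
      using eventually_ge_at_top[of t] by eventually_elim (rule mono[OF that])
  qed simp
  then have q: "q1 t = q2 t" if "0 \<le> t" for t
    using that by simp
  show ?thesis
    using forward_comparison[OF w1 w2 _ _ s] forward_comparison[OF w2 w1 _ _ s] q init
    by (intro antisym) simp_all
qed

lemma y_solution_unique: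
  assumes "0 < \<beta>" and 1: "y_solution \<delta> \<rho> \<beta> x y1" and 2: "y_solution \<delta> \<rho> \<beta> x y2" and s: "0 \<le> s"
  shows "y1 s = y2 s"
proof -
  obtain p1 p2 where p: "solves_linear \<delta> (\<rho> + \<delta>) x (\<lambda>s. y1 s powr (- \<beta>)) y1 p1"
    "solves_linear \<delta> (\<rho> + \<delta>) x (\<lambda>s. y2 s powr (- \<beta>)) y2 p2"
    and pos: "\<And>s. 0 \<le> s \<Longrightarrow> 0 < y1 s" "\<And>s. 0 \<le> s \<Longrightarrow> 0 < y2 s"
    using 1 2 unfolding y_solution_iff_solves_linear by blast
  have "antimono_on {0<..} (\<lambda>v::real. v powr (- \<beta>))"
    using \<open>0 < \<beta>\<close> by (auto intro!: monotone_onI powr_mono2')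
  from decreasing_feedback_unique[OF p this _ _ s] show ?thesis
    using pos by simp
qed

section \<open>Existence\<close>

text \<open>The defining equation of the steady state: \<open>y\<close> is stationary when \<open>p = \<delta> y\<close>, and then \<open>p\<close> is
  stationary when \<open>(\<rho> + \<delta>) \<delta> y = y powr - \<beta>\<close>.\<close>

lemma y_inf_fixed_point:
  assumes "0 < \<delta>" "0 < \<rho>" "0 < \<beta>"
  shows "0 < y_inf \<delta> \<rho> \<beta>" and "y_inf \<delta> \<rho> \<beta> powr (- \<beta>) = \<delta> * (\<rho> + \<delta>) * y_inf \<delta> \<rho> \<beta>"
proof -
  let ?K = "\<delta> * (\<rho> + \<delta>)"
  have K: "0 < ?K" using assms by simp
  then show "0 < y_inf \<delta> \<rho> \<beta>"
    unfolding y_inf_def by (simp only: powr_gt_zero)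
  have "y_inf \<delta> \<rho> \<beta> powr (- \<beta>) = ?K powr (\<beta> / (\<beta> + 1))"
    by (simp add: y_inf_def powr_powr)
  also have "\<beta> / (\<beta> + 1) = 1 + - 1 / (\<beta> + 1)"
    using assms by (simp add: field_simps)
  also have "?K powr \<dots> = ?K powr 1 * ?K powr (- 1 / (\<beta> + 1))"
    by (rule powr_add)
  also have "\<dots> = ?K * y_inf \<delta> \<rho> \<beta>"
    using K by (simp add: y_inf_def)
  finally show "y_inf \<delta> \<rho> \<beta> powr (- \<beta>) = ?K * y_inf \<delta> \<rho> \<beta>" .
qed

text \<open>With rates \<open>a\<close>, \<open>b = a + \<rho>\<close> and source \<open>G y = k y + y powr - \<beta>\<close>, \<open>k = a b - \<kappa>\<close>, the second-order
  equation for \<open>y\<close> is the same as with rates \<open>\<delta>\<close>, \<open>\<rho> + \<delta>\<close> and source \<open>y powr - \<beta>\<close>. On the interval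
  between \<open>x\<close> and \<open>y\<^sub>\<infinity>\<close> the source \<open>G\<close> is increasing once \<open>k\<close> dominates the slope of
  \<open>y powr - \<beta>\<close>, and then \<open>k < a b\<close> is a Lipschitz constant. Truncating the argument of \<open>G\<close> to that
  interval makes the source globally Lipschitz and bounded; comparison shows afterwards that the
  truncation is inactive.\<close>

lemma y_solution_exists:
  assumes "0 < \<delta>" "0 < \<rho>" "0 < \<beta>" and x: "0 < x"
  shows "\<exists>y. y_solution \<delta> \<rho> \<beta> x y \<and>
    (x < y_inf \<delta> \<rho> \<beta> \<longrightarrow> (\<forall>s\<ge>0. y s < y_inf \<delta> \<rho> \<beta>)) \<and>
    (y_inf \<delta> \<rho> \<beta> < x \<longrightarrow> (\<forall>s\<ge>0. y_inf \<delta> \<rho> \<beta> < y s))"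
proof -
  define Y where "Y = y_inf \<delta> \<rho> \<beta>"
  define \<kappa> where "\<kappa> = \<delta> * (\<rho> + \<delta>)"
  have \<kappa>: "0 < \<kappa>" using assms by (simp add: \<kappa>_def)
  have Y: "0 < Y" "Y powr (- \<beta>) = \<kappa> * Y"
    using y_inf_fixed_point[OF assms(1-3)] by (simp_all add: Y_def \<kappa>_def)
  define m where "m = min x Y"
  define K where "K = max x Y"
  have mK: "0 < m" "m \<le> x" "x \<le> K" "m \<le> Y" "Y \<le> K"
    using x Y by (auto simp: m_def K_def)
  \<comment> \<open>The largest slope of \<open>v \<mapsto> v powr - \<beta>\<close> on \<open>{m..}\<close>, in absolute value.\<close>
  define L where "L = \<beta> * m powr (- \<beta> - 1)"
  have L: "0 \<le> L" using assms by (simp add: L_def)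
  \<comment> \<open>Large enough for \<open>k \<ge> L\<close>; the summand \<open>1\<close> gives \<open>b \<ge> 1\<close>, so that \<open>a b \<ge> a\<close>.\<close>
  define a where "a = \<kappa> + L + 1"
  define b where "b = a + \<rho>"
  have a: "0 < a" "1 \<le> a" and b: "0 < b" "a \<le> b"
    using \<kappa> L assms by (auto simp: a_def b_def)
  define k where "k = a * b - \<kappa>"
  have "a * 1 \<le> a * b"
    using a b by (intro mult_left_mono) auto
  then have k: "0 \<le> k" "L \<le> k" "k < a * b"
    using \<kappa> L a_def unfolding k_def by linarith+
  define G where "G = (\<lambda>v. k * v + v powr (- \<beta>))"
  have G_mono: "G u \<le> G v" if "m \<le> u" "u \<le> v" for u v
  proof (rule DERIV_nonneg_imp_nondecreasing[OF that(2)])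
    fix t assume t: "u \<le> t" "t \<le> v"
    then have "0 < t" using that mK by simp
    then have "(G has_real_derivative k - \<beta> * t powr (- \<beta> - 1)) (at t)"
      unfolding G_def by (auto intro!: derivative_eq_intros simp: field_simps)
    moreover have "t powr (- \<beta> - 1) \<le> m powr (- \<beta> - 1)"
      using mK t that assms by (intro powr_mono2') auto
    then have "\<beta> * t powr (- \<beta> - 1) \<le> L"
      unfolding L_def using assms by (intro mult_left_mono) auto
    ultimately show "\<exists>d. (G has_real_derivative d) (at t) \<and> 0 \<le> d"
      using k(2) by (intro exI[of _ "k - \<beta> * t powr (- \<beta> - 1)"]) simp
  qed
  have G_lip: "G v - G u \<le> k * (v - u)" if "m \<le> u" "u \<le> v" for u v
    using powr_mono2'[of "- \<beta>" u v] that mK assms by (simp add: G_def algebra_simps)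
  define cl where "cl = (\<lambda>v. max m (min K v))"
  have cl: "m \<le> cl v" "cl v \<le> K" for v
    using mK by (auto simp: cl_def)
  have cl_mono: "cl u \<le> cl v" "cl v - cl u \<le> v - u" if "u \<le> v" for u v
    using that by (auto simp: cl_def)
  define H where "H = (\<lambda>v. G (cl v))"
  have H_step: "\<bar>H v - H u\<bar> \<le> k * (v - u)" if "u \<le> v" for u v
  proof -
    have "G (cl v) - G (cl u) \<le> k * (cl v - cl u)"
      by (rule G_lip[OF cl(1) cl_mono(1)[OF that]])
    also have "\<dots> \<le> k * (v - u)"
      by (rule mult_left_mono[OF cl_mono(2)[OF that] k(1)])
    finally show ?thesis
      using G_mono[OF cl(1) cl_mono(1)[OF that]] by (simp add: H_def)
  qed
  have lip: "\<bar>H u - H v\<bar> \<le> k * \<bar>u - v\<bar>" for u v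
    using H_step[of u v] H_step[of v u] by (cases "u \<le> v") (auto simp: abs_minus_commute)
  have H_bounds: "G m \<le> H v" "H v \<le> G K" for v
    unfolding H_def by (rule G_mono; use cl in simp)+
  have G0: "0 \<le> G m" using mK k by (simp add: G_def)
  have "\<bar>H v\<bar> \<le> G K" for v
    using H_bounds[of v] G0 by simp
  from semilinear_problem_solvable[OF a(1) b(1) k(1,3) lip this] obtain y q
    where sol: "solves_linear a b x (\<lambda>s. H (y s)) y q" by blast
  have y: "(y has_real_derivative - a * y s + q s) (at s within {0..})"
    and q: "(q has_real_derivative b * q s - H (y s)) (at s within {0..})" if "0 \<le> s" for s
    using sol that by (simp_all add: solves_linear_def)
  have lim: "((\<lambda>s. exp (- b * s) * q s) \<longlongrightarrow> 0) at_top" and y0: "y 0 = x"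
    using sol by (simp_all add: solves_linear_def)
  \<comment> \<open>The endpoints \<open>m\<close> and \<open>K\<close> lie on either side of the steady state, so \<open>m\<close> is a subsolution and
    \<open>K\<close> a supersolution.\<close>
  have "K powr (- \<beta>) \<le> Y powr (- \<beta>)"
    using mK Y assms by (intro powr_mono2') auto
  also have "\<dots> \<le> \<kappa> * K"
    using Y(2) mK \<kappa> by simp
  finally have GK: "G K / b \<le> a * K"
    using b by (simp add: G_def k_def field_simps)
  have "\<kappa> * m \<le> Y powr (- \<beta>)"
    using Y(2) mK \<kappa> by simp
  also have "\<dots> \<le> m powr (- \<beta>)"
    using mK Y assms by (intro powr_mono2') auto
  finally have Gm: "a * m \<le> G m / b"
    using b by (simp add: G_def k_def field_simps)
  have qK: "q s \<le> a * K" if "0 \<le> s" for s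
    using backward_le_const[OF b(1) q lim that, of "G K"] H_bounds GK by force
  have qm: "a * m \<le> q s" if "0 \<le> s" for s
    using backward_ge_const[OF b(1) q lim that, of "G m"] H_bounds Gm by force
  have yK: "y s \<le> K + exp (- a * s) * (x - K)" if "0 \<le> s" for s
    using forward_le_relax[OF y that qK] y0 by simp
  have ym: "m + exp (- a * s) * (x - m) \<le> y s" if "0 \<le> s" for s
    using forward_ge_relax[OF y that qm] y0 by simp
  have y_in: "m \<le> y s" "y s \<le> K" if "0 \<le> s" for s
  proof -
    have "exp (- a * s) * (x - K) \<le> 0" "0 \<le> exp (- a * s) * (x - m)"
      using mK by (simp_all add: mult_le_0_iff)
    then show "m \<le> y s" "y s \<le> K"
      using yK[OF that] ym[OF that] by linarith+
  qed
  \<comment> \<open>Forced by \<open>y' = - a y + q = - \<delta> y + p\<close>.\<close>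
  define p where "p = (\<lambda>s. (\<delta> - a) * y s + q s)"
  have "solves_linear \<delta> (\<rho> + \<delta>) x (\<lambda>s. y s powr (- \<beta>)) y p"
    unfolding solves_linear_def
  proof (intro conjI allI impI)
    fix s :: real assume s: "0 \<le> s"
    show "(y has_real_derivative - \<delta> * y s + p s) (at s within {0..})"
      using y[OF s] by (simp add: p_def algebra_simps)
    have "cl (y s) = y s"
      using y_in[OF s] by (simp add: cl_def)
    then have H: "H (y s) = k * y s + y s powr (- \<beta>)"
      by (simp add: H_def G_def)
    have "(p has_real_derivative (\<delta> - a) * (- a * y s + q s) + (b * q s - H (y s))) (at s within {0..})"
      unfolding p_def by (auto intro!: derivative_eq_intros y[OF s] q[OF s])
    also have "(\<delta> - a) * (- a * y s + q s) + (b * q s - H (y s)) = (\<rho> + \<delta>) * p s - y s powr (- \<beta>)"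
      by (simp add: H p_def k_def \<kappa>_def b_def algebra_simps)
    finally show "(p has_real_derivative (\<rho> + \<delta>) * p s - y s powr (- \<beta>)) (at s within {0..})" .
  next
    define B where "B = \<bar>\<delta> - a\<bar> * K + a * K"
    have B: "\<bar>p s\<bar> \<le> B" if "0 \<le> s" for s
    proof -
      have "0 \<le> a * m"
        using a mK by simp
      then have "\<bar>y s\<bar> \<le> K" "\<bar>q s\<bar> \<le> a * K"
        using y_in[OF that] mK qK[OF that] qm[OF that] by linarith+
      then have "\<bar>(\<delta> - a) * y s\<bar> + \<bar>q s\<bar> \<le> B"
        unfolding B_def abs_mult by (intro add_mono mult_left_mono) auto
      then show ?thesis unfolding p_def by linarith
    qed
    show "((\<lambda>s. exp (- (\<rho> + \<delta>) * s) * p s) \<longlongrightarrow> 0) at_top"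
    proof (rule Lim_null_comparison)
      show "\<forall>\<^sub>F s in at_top. norm (exp (- (\<rho> + \<delta>) * s) * p s) \<le> exp (- (\<rho> + \<delta>) * s) * B"
        using eventually_ge_at_top[of 0]
        by eventually_elim (use B in \<open>simp add: abs_mult\<close>)
      show "((\<lambda>s. exp (- (\<rho> + \<delta>) * s) * B) \<longlongrightarrow> 0) at_top"
        by (rule exp_neg_mult_tendsto_0) (use assms in simp)
    qed
  qed (rule y0)
  moreover have "0 < y s" if "0 \<le> s" for s
    using y_in(1)[OF that] mK by simp
  ultimately have "y_solution \<delta> \<rho> \<beta> x y"
    unfolding y_solution_iff_solves_linear by blast
  \<comment> \<open>If \<open>x\<close> is not the steady state, the endpoint other than \<open>x\<close> is \<open>Y\<close>, and the exponential term
    in the comparison bound keeps \<open>y\<close> away from it.\<close>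
  moreover have "y s < Y" if "x < Y" "0 \<le> s" for s
  proof -
    have K: "K = Y" using that by (simp add: K_def)
    have "exp (- a * s) * (x - Y) < 0"
      using that by (simp add: mult_less_0_iff)
    then show ?thesis
      using yK[OF that(2)] unfolding K by linarith
  qed
  moreover have "Y < y s" if "Y < x" "0 \<le> s" for s
  proof -
    have m: "m = Y" using that by (simp add: m_def)
    have "0 < exp (- a * s) * (x - Y)"
      using that by simp
    then show ?thesis
      using ym[OF that(2)] unfolding m by linarith
  qed
  ultimately show ?thesis
    unfolding Y_def by blast
qed

section \<open>A priori bounds and regularity\<close>

text \<open>As \<open>p \<ge> 0\<close>, \<open>y\<close> cannot decay faster than
  \<open>exp (- \<delta> s) x\<close>; feeding this into the source bounds \<open>p\<close> by the solution \<open>exp (\<delta> \<beta> s) c\<close> of an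
  explicit backward equation, and this in turn bounds \<open>y\<close>. The assumption on \<open>\<beta>\<close> is what makes
  \<open>exp (\<delta> \<beta> s)\<close> admissible at infinity for the rate \<open>\<rho> + \<delta>\<close>.\<close>

lemma y_solution_bounds:
  assumes "0 < \<delta>" "0 < \<rho>" "0 < \<beta>" and \<beta>: "\<beta> < 1 + \<rho> / \<delta>"
    and sol: "y_solution \<delta> \<rho> \<beta> x y"
  shows "y_bounds \<delta> \<rho> \<beta> x y"
  unfolding y_bounds_def
proof (intro allI impI conjI)
  obtain p where sys: "solves_linear \<delta> (\<rho> + \<delta>) x (\<lambda>s. y s powr (- \<beta>)) y p"
    and pos: "\<And>s. 0 \<le> s \<Longrightarrow> 0 < y s"
    using sol unfolding y_solution_iff_solves_linear by blast
  have y: "(y has_real_derivative - \<delta> * y s + p s) (at s within {0..})"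
    and p: "(p has_real_derivative (\<rho> + \<delta>) * p s - y s powr (- \<beta>)) (at s within {0..})"
    if "0 \<le> s" for s
    using sys that by (simp_all add: solves_linear_def)
  have lim: "((\<lambda>s. exp (- (\<rho> + \<delta>) * s) * p s) \<longlongrightarrow> 0) at_top" and y0: "y 0 = x"
    using sys by (simp_all add: solves_linear_def)
  have b: "0 < \<rho> + \<delta>" using assms by simp
  have "0 / (\<rho> + \<delta>) \<le> p s" if "0 \<le> s" for s
    by (rule backward_ge_const[OF b p lim that]) simp_all
  then have p_nn: "\<delta> * 0 \<le> p s" if "0 \<le> s" for s
    using that by simp
  have lower: "exp (- \<delta> * s) * x \<le> y s" if "0 \<le> s" for s
    using forward_ge_relax[OF y that p_nn] y0 by simp
  fix s :: real assume s: "0 \<le> s"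
  show "exp (- \<delta> * s) * x \<le> y s" by (rule lower[OF s])
  define r where "r = \<rho> + \<delta> - \<delta> * \<beta>"
  have r: "0 < r"
    using \<beta> \<open>0 < \<delta>\<close> by (simp add: r_def field_simps)
  define c where "c = x powr (- \<beta>) / r"
  have x: "0 < x" using pos[of 0] y0 by simp
  have g_le: "y t powr (- \<beta>) \<le> exp (\<delta> * \<beta> * t) * x powr (- \<beta>)" if "0 \<le> t" for t
  proof -
    have "y t powr (- \<beta>) \<le> (exp (- \<delta> * t) * x) powr (- \<beta>)"
      using lower[OF that] x assms by (intro powr_mono2') auto
    also have "\<dots> = exp (\<delta> * \<beta> * t) * x powr (- \<beta>)"
      by (simp add: powr_mult exp_powr_real algebra_simps)
    finally show ?thesis .
  qed
  have p_le: "p t \<le> exp (\<delta> * \<beta> * t) * c" if "0 \<le> t" for t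
  proof (rule backward_comparison[OF p _ lim _ g_le that])
    have xc: "x powr (- \<beta>) = c * r" using r by (simp add: c_def)
    show "((\<lambda>t. exp (\<delta> * \<beta> * t) * c) has_real_derivative
        (\<rho> + \<delta>) * (exp (\<delta> * \<beta> * t) * c) - exp (\<delta> * \<beta> * t) * x powr (- \<beta>)) (at t within {0..})" for t
      by (auto intro!: derivative_eq_intros simp: xc r_def algebra_simps)
    have "(\<lambda>t. exp (- (\<rho> + \<delta>) * t) * (exp (\<delta> * \<beta> * t) * c)) = (\<lambda>t. exp (- r * t) * c)"
      by (auto simp: r_def algebra_simps simp flip: exp_add mult.assoc[of "exp _" "exp _"])
    then show "((\<lambda>t. exp (- (\<rho> + \<delta>) * t) * (exp (\<delta> * \<beta> * t) * c)) \<longlongrightarrow> 0) at_top"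
      using exp_neg_mult_tendsto_0[OF r, of c] by simp
  qed simp_all
  define A where "A = x powr (- \<beta>) / (\<delta> * (1 + \<beta>) * (\<rho> + \<delta> - \<delta> * \<beta>))"
  have cA: "c = \<delta> * (1 + \<beta>) * A"
    using r assms unfolding c_def A_def r_def[symmetric] by simp
  have "y s \<le> exp (- \<delta> * s) * (x - A) + exp (\<delta> * \<beta> * s) * A"
  proof (rule forward_comparison[OF y _ _ p_le s])
    show "((\<lambda>t. exp (- \<delta> * t) * (x - A) + exp (\<delta> * \<beta> * t) * A) has_real_derivative
        - \<delta> * (exp (- \<delta> * t) * (x - A) + exp (\<delta> * \<beta> * t) * A) + exp (\<delta> * \<beta> * t) * c)
        (at t within {0..})" for t
      by (auto intro!: derivative_eq_intros simp: cA algebra_simps)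
  qed (simp_all add: y0)
  then show "y s \<le> exp (- \<delta> * s) * (x - x powr (- \<beta>) / (\<delta> * (1 + \<beta>) * (\<rho> + \<delta> - \<delta> * \<beta>)))
      + exp (\<delta> * \<beta> * s) * x powr (- \<beta>) / (\<delta> * (1 + \<beta>) * (\<rho> + \<delta> - \<delta> * \<beta>))"
    by (simp add: A_def)
qed

text \<open>The exponential factor allows \<open>y\<close> (\<open>c = 0\<close>) and \<open>z\<close> (\<open>c = \<delta>\<close>) to be treated together.\<close>

lemma y_solution_C2:
  assumes sol: "y_solution \<delta> \<rho> \<beta> x y"
  shows "Ck_on 2 {0..} (\<lambda>s. exp (c * s) * y s)"
proof -
  obtain p where sys: "solves_linear \<delta> (\<rho> + \<delta>) x (\<lambda>s. y s powr (- \<beta>)) y p"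
    and pos: "\<And>s. 0 \<le> s \<Longrightarrow> 0 < y s"
    using sol unfolding y_solution_iff_solves_linear by blast
  have y: "(y has_real_derivative - \<delta> * y s + p s) (at s within {0..})"
    and p: "(p has_real_derivative (\<rho> + \<delta>) * p s - y s powr (- \<beta>)) (at s within {0..})"
    if "0 \<le> s" for s
    using sys that by (simp_all add: solves_linear_def)
  have conty: "continuous_on {0..} y"
    by (rule DERIV_continuous_on) (use y in auto)
  have contp: "continuous_on {0..} p"
    by (rule DERIV_continuous_on) (use p in auto)
  have cont: "continuous_on {0..} (\<lambda>s. y s powr (- \<beta>))"
    by (rule continuous_on_powr) (use conty pos in \<open>auto simp: less_imp_neq[symmetric]\<close>)
  let ?d1 = "\<lambda>s. exp (c * s) * ((c - \<delta>) * y s + p s)"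
  let ?d2 = "\<lambda>s. exp (c * s) * (c * ((c - \<delta>) * y s + p s) +
    ((c - \<delta>) * (- \<delta> * y s + p s) + ((\<rho> + \<delta>) * p s - y s powr (- \<beta>))))"
  have 1: "((\<lambda>s. exp (c * s) * y s) has_real_derivative ?d1 s) (at s within {0..})" if "0 \<le> s" for s
    by (auto intro!: derivative_eq_intros y[OF that] simp: algebra_simps)
  have 2: "(?d1 has_real_derivative ?d2 s) (at s within {0..})" if "0 \<le> s" for s
    by (auto intro!: derivative_eq_intros y[OF that] p[OF that] simp: algebra_simps)
  have 3: "continuous_on {0..} ?d2"
    by (intro continuous_intros conty contp cont)
  show ?thesis
    unfolding numeral_2_eq_2 Ck_on.simps
    by (intro exI[of _ ?d1] exI[of _ ?d2] conjI ballI 1 2 3) auto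
qed

lemma C_set_of_y_bounds:
  assumes "y_solution \<delta> \<rho> \<beta> x y" "y_bounds \<delta> \<rho> \<beta> x y"
  shows "(\<lambda>s. exp (\<delta> * s) * y s) \<in> C_set \<delta> \<rho> \<beta> x"
proof -
  define A where "A = x powr (- \<beta>) / (\<delta> * (1 + \<beta>) * (\<rho> + \<delta> - \<delta> * \<beta>))"
  have alpha: "alpha_bar \<delta> \<rho> \<beta> x s = x - A + exp (\<delta> * (1 + \<beta>) * s) * A" for s
    by (simp add: alpha_bar_def A_def diff_divide_distrib algebra_simps)
  have "continuous_on {0..} y"
    by (rule DERIV_continuous_on) (use assms(1) in \<open>auto simp: y_solution_def\<close>)
  then have cont: "continuous_on {0..} (\<lambda>s. exp (\<delta> * s) * y s)"
    by (intro continuous_intros)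
  have pos: "0 < exp (\<delta> * s) * y s" if "0 \<le> s" for s
    using assms(1) that by (simp add: y_solution_def)
  have "x \<le> exp (\<delta> * s) * y s \<and> exp (\<delta> * s) * y s \<le> alpha_bar \<delta> \<rho> \<beta> x s" if "0 \<le> s" for s
  proof
    have lo: "exp (- \<delta> * s) * x \<le> y s"
      and up: "y s \<le> exp (- \<delta> * s) * (x - A) + exp (\<delta> * \<beta> * s) * A"
      using assms(2) that by (simp_all add: y_bounds_def A_def)
    have "x = exp (\<delta> * s) * (exp (- \<delta> * s) * x)"
      by (simp add: exp_minus)
    also have "\<dots> \<le> exp (\<delta> * s) * y s"
      by (rule mult_left_mono[OF lo]) simp
    finally show "x \<le> exp (\<delta> * s) * y s" .
    have "exp (\<delta> * s) * y s \<le> exp (\<delta> * s) * (exp (- \<delta> * s) * (x - A) + exp (\<delta> * \<beta> * s) * A)"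
      by (rule mult_left_mono[OF up]) simp
    also have "\<dots> = (exp (\<delta> * s) * exp (- \<delta> * s)) * (x - A) + (exp (\<delta> * s) * exp (\<delta> * \<beta> * s)) * A"
      by (simp add: algebra_simps)
    also have "\<dots> = alpha_bar \<delta> \<rho> \<beta> x s"
      unfolding alpha by (simp add: algebra_simps flip: exp_add)
    finally show "exp (\<delta> * s) * y s \<le> alpha_bar \<delta> \<rho> \<beta> x s" .
  qed
  with cont pos show ?thesis by (simp add: C_set_def)
qed

section \<open>Monotonicity and convergence to the steady state\<close>

text \<open>Below \<open>y\<^sub>\<infinity>\<close> the source exceeds its steady value, hence so does \<open>p\<close>, that is \<open>p \<ge> \<delta> y\<^sub>\<infinity>\<close>. Then
  \<open>y' \<ge> \<delta> (y\<^sub>\<infinity> - y)\<close>, which is positive and forces convergence at rate \<open>\<delta>\<close>.\<close>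

lemma y_solution_below_y_inf:
  assumes "0 < \<delta>" "0 < \<rho>" "0 < \<beta>" and sol: "y_solution \<delta> \<rho> \<beta> x y"
    and below: "\<And>s. 0 \<le> s \<Longrightarrow> y s < y_inf \<delta> \<rho> \<beta>"
  shows "strict_mono_on {0..} y" and "(y \<longlongrightarrow> y_inf \<delta> \<rho> \<beta>) at_top"
proof -
  let ?Y = "y_inf \<delta> \<rho> \<beta>"
  note Y = y_inf_fixed_point[OF assms(1-3)]
  obtain p where sys: "solves_linear \<delta> (\<rho> + \<delta>) x (\<lambda>s. y s powr (- \<beta>)) y p"
    and pos: "\<And>s. 0 \<le> s \<Longrightarrow> 0 < y s"
    using sol unfolding y_solution_iff_solves_linear by blast
  have y: "(y has_real_derivative - \<delta> * y s + p s) (at s within {0..})"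
    and p: "(p has_real_derivative (\<rho> + \<delta>) * p s - y s powr (- \<beta>)) (at s within {0..})"
    if "0 \<le> s" for s
    using sys that by (simp_all add: solves_linear_def)
  have lim: "((\<lambda>s. exp (- (\<rho> + \<delta>) * s) * p s) \<longlongrightarrow> 0) at_top"
    using sys by (simp add: solves_linear_def)
  have b: "0 < \<rho> + \<delta>" using assms by simp
  have "\<delta> * (\<rho> + \<delta>) * ?Y \<le> y s powr (- \<beta>)" if "0 \<le> s" for s
    unfolding Y(2)[symmetric]
    using below[OF that] pos[OF that] assms by (intro powr_mono2') auto
  then have "\<delta> * (\<rho> + \<delta>) * ?Y / (\<rho> + \<delta>) \<le> p s" if "0 \<le> s" for s
    using backward_ge_const[OF b p lim that] by blast
  then have p_ge: "\<delta> * ?Y \<le> p s" if "0 \<le> s" for s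
    using that b by force
  have incr: "0 < - \<delta> * y s + p s" if "0 \<le> s" for s
    using p_ge[OF that] mult_strict_left_mono[OF below[OF that] \<open>0 < \<delta>\<close>] by simp
  show "strict_mono_on {0..} y"
    by (rule strict_mono_half_line[OF y incr])
  have lower: "?Y + exp (- \<delta> * s) * (y 0 - ?Y) \<le> y s" if "0 \<le> s" for s
    by (rule forward_ge_relax[OF y that p_ge])
  have "((\<lambda>s. ?Y + exp (- \<delta> * s) * (y 0 - ?Y)) \<longlongrightarrow> ?Y + 0) at_top"
    by (intro tendsto_add tendsto_const exp_neg_mult_tendsto_0 assms)
  then have l: "((\<lambda>s. ?Y + exp (- \<delta> * s) * (y 0 - ?Y)) \<longlongrightarrow> ?Y) at_top" by simp
  show "(y \<longlongrightarrow> ?Y) at_top"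
  proof (rule tendsto_sandwich[OF _ _ l tendsto_const])
    show "\<forall>\<^sub>F s in at_top. ?Y + exp (- \<delta> * s) * (y 0 - ?Y) \<le> y s"
      using eventually_ge_at_top[of 0] by eventually_elim (rule lower)
    show "\<forall>\<^sub>F s in at_top. y s \<le> ?Y"
      using eventually_ge_at_top[of 0] by eventually_elim (rule less_imp_le[OF below])
  qed
qed

lemma y_solution_above_y_inf:
  assumes "0 < \<delta>" "0 < \<rho>" "0 < \<beta>" and sol: "y_solution \<delta> \<rho> \<beta> x y"
    and above: "\<And>s. 0 \<le> s \<Longrightarrow> y_inf \<delta> \<rho> \<beta> < y s"
  shows "strict_antimono_on {0..} y" and "(y \<longlongrightarrow> y_inf \<delta> \<rho> \<beta>) at_top"
proof -
  let ?Y = "y_inf \<delta> \<rho> \<beta>"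
  note Y = y_inf_fixed_point[OF assms(1-3)]
  obtain p where sys: "solves_linear \<delta> (\<rho> + \<delta>) x (\<lambda>s. y s powr (- \<beta>)) y p"
    using sol unfolding y_solution_iff_solves_linear by blast
  have y: "(y has_real_derivative - \<delta> * y s + p s) (at s within {0..})"
    and p: "(p has_real_derivative (\<rho> + \<delta>) * p s - y s powr (- \<beta>)) (at s within {0..})"
    if "0 \<le> s" for s
    using sys that by (simp_all add: solves_linear_def)
  have lim: "((\<lambda>s. exp (- (\<rho> + \<delta>) * s) * p s) \<longlongrightarrow> 0) at_top"
    using sys by (simp add: solves_linear_def)
  have b: "0 < \<rho> + \<delta>" using assms by simp
  have "y s powr (- \<beta>) \<le> \<delta> * (\<rho> + \<delta>) * ?Y" if "0 \<le> s" for s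
    unfolding Y(2)[symmetric]
    using above[OF that] Y(1) assms by (intro powr_mono2') auto
  then have "p s \<le> \<delta> * (\<rho> + \<delta>) * ?Y / (\<rho> + \<delta>)" if "0 \<le> s" for s
    using backward_le_const[OF b p lim that] by blast
  then have p_le: "p s \<le> \<delta> * ?Y" if "0 \<le> s" for s
    using that b by force
  have neg: "((\<lambda>s. - y s) has_real_derivative - (- \<delta> * y s + p s)) (at s within {0..})" if "0 \<le> s" for s
    by (rule DERIV_minus[OF y[OF that]])
  have decr: "0 < - (- \<delta> * y s + p s)" if "0 \<le> s" for s
    using p_le[OF that] mult_strict_left_mono[OF above[OF that] \<open>0 < \<delta>\<close>] by simp
  have "strict_mono_on {0..} (\<lambda>s. - y s)"
    by (rule strict_mono_half_line[OF neg decr])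
  then show "strict_antimono_on {0..} y"
    by (simp add: monotone_on_def)
  have upper: "y s \<le> ?Y + exp (- \<delta> * s) * (y 0 - ?Y)" if "0 \<le> s" for s
    by (rule forward_le_relax[OF y that p_le])
  have "((\<lambda>s. ?Y + exp (- \<delta> * s) * (y 0 - ?Y)) \<longlongrightarrow> ?Y + 0) at_top"
    by (intro tendsto_add tendsto_const exp_neg_mult_tendsto_0 assms)
  then have l: "((\<lambda>s. ?Y + exp (- \<delta> * s) * (y 0 - ?Y)) \<longlongrightarrow> ?Y) at_top" by simp
  show "(y \<longlongrightarrow> ?Y) at_top"
  proof (rule tendsto_sandwich[OF _ _ tendsto_const l])
    show "\<forall>\<^sub>F s in at_top. y s \<le> ?Y + exp (- \<delta> * s) * (y 0 - ?Y)"
      using eventually_ge_at_top[of 0] by eventually_elim (rule upper)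
    show "\<forall>\<^sub>F s in at_top. ?Y \<le> y s"
      using eventually_ge_at_top[of 0] by eventually_elim (rule less_imp_le[OF above])
  qed
qed

lemma y_inf_solution:
  assumes "0 < \<delta>" "0 < \<rho>" "0 < \<beta>"
  shows "y_solution \<delta> \<rho> \<beta> (y_inf \<delta> \<rho> \<beta>) (\<lambda>_. y_inf \<delta> \<rho> \<beta>)"
proof -
  let ?Y = "y_inf \<delta> \<rho> \<beta>"
  note Y = y_inf_fixed_point[OF assms]
  have "((\<lambda>s. exp (- (\<rho> + \<delta>) * s) * (\<delta> * ?Y)) \<longlongrightarrow> 0) at_top"
    by (rule exp_neg_mult_tendsto_0) (use assms in simp)
  then have "solves_linear \<delta> (\<rho> + \<delta>) ?Y (\<lambda>s. ?Y powr (- \<beta>)) (\<lambda>_. ?Y) (\<lambda>_. \<delta> * ?Y)"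
    unfolding solves_linear_def Y(2) by (auto intro!: derivative_eq_intros)
  then show ?thesis
    unfolding y_solution_iff_solves_linear using Y(1) by blast
qed

lemma y_solution_monotone_convergent:
  assumes "0 < \<delta>" "0 < \<rho>" "0 < \<beta>" and sol: "y_solution \<delta> \<rho> \<beta> x y" and ne: "x \<noteq> y_inf \<delta> \<rho> \<beta>"
  shows "strict_mono_on {0..} y \<or> strict_antimono_on {0..} y"
    and "(y \<longlongrightarrow> y_inf \<delta> \<rho> \<beta>) at_top"
proof -
  have x: "0 < x"
    using sol by (auto simp: y_solution_def)
  obtain y' where y': "y_solution \<delta> \<rho> \<beta> x y'"
    and side: "x < y_inf \<delta> \<rho> \<beta> \<Longrightarrow> \<forall>s\<ge>0. y' s < y_inf \<delta> \<rho> \<beta>"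
      "y_inf \<delta> \<rho> \<beta> < x \<Longrightarrow> \<forall>s\<ge>0. y_inf \<delta> \<rho> \<beta> < y' s"
    using y_solution_exists[OF assms(1-3) x] by blast
  have eq: "y s = y' s" if "0 \<le> s" for s
    by (rule y_solution_unique[OF \<open>0 < \<beta>\<close> sol y' that])
  consider "x < y_inf \<delta> \<rho> \<beta>" | "y_inf \<delta> \<rho> \<beta> < x"
    using ne by linarith
  then have "(strict_mono_on {0..} y \<or> strict_antimono_on {0..} y) \<and> (y \<longlongrightarrow> y_inf \<delta> \<rho> \<beta>) at_top"
  proof cases
    case 1
    then have "y s < y_inf \<delta> \<rho> \<beta>" if "0 \<le> s" for s
      using side(1) eq[OF that] that by simp
    then show ?thesis
      using y_solution_below_y_inf[OF assms(1-3) sol] by blast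
  next
    case 2
    then have "y_inf \<delta> \<rho> \<beta> < y s" if "0 \<le> s" for s
      using side(2) eq[OF that] that by simp
    then show ?thesis
      using y_solution_above_y_inf[OF assms(1-3) sol] by blast
  qed
  then show "strict_mono_on {0..} y \<or> strict_antimono_on {0..} y"
    and "(y \<longlongrightarrow> y_inf \<delta> \<rho> \<beta>) at_top" by blast+
qed

text \<open>A solution that does not start at \<open>y\<^sub>\<infinity>\<close> is strictly monotone, so it is not constant.\<close>

lemma constant_y_solution:
  assumes "0 < \<delta>" "0 < \<rho>" "0 < \<beta>" and sol: "y_solution \<delta> \<rho> \<beta> x w"
    and const: "w constant_on {0..}" and s: "0 \<le> s"
  shows "w s = y_inf \<delta> \<rho> \<beta>"
proof -
  obtain c where c: "\<And>s. 0 \<le> s \<Longrightarrow> w s = c"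
    using const by (auto simp: constant_on_def)
  have "w 0 = x"
    using sol by (simp add: y_solution_def)
  moreover have "\<not> (strict_mono_on {0..} w \<or> strict_antimono_on {0..} w)"
    using c[of 0] c[of 1] monotone_onD[of "{0..}" "(<)" _ w 0 1] by auto
  ultimately show ?thesis
    using y_solution_monotone_convergent(1)[OF assms(1-4)] c[of 0] c[OF s] by auto
qed

theorem theorem4p11:
  fixes \<delta> \<rho> \<beta> x :: real
  assumes "\<delta> > 0" and "\<rho> > 0" and "\<beta> > 0" and "\<beta> < 1 + \<rho> / \<delta>" and "x > 0"
  shows "(\<exists>z\<in>C_set \<delta> \<rho> \<beta> x.
            z_solution \<delta> \<rho> \<beta> x z \<and> Ck_on 2 {0..} z \<and>
            (\<forall>w\<in>C_set \<delta> \<rho> \<beta> x. z_solution \<delta> \<rho> \<beta> x w \<longrightarrow> (\<forall>s\<ge>0. w s = z s)))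
       \<and> (\<exists>y. y_solution \<delta> \<rho> \<beta> x y \<and> Ck_on 2 {0..} y \<and> y_bounds \<delta> \<rho> \<beta> x y \<and>
            (\<forall>w. y_solution \<delta> \<rho> \<beta> x w \<and> y_bounds \<delta> \<rho> \<beta> x w \<longrightarrow> (\<forall>s\<ge>0. w s = y s)))
       \<and> (x = y_inf \<delta> \<rho> \<beta> \<longrightarrow>
            y_solution \<delta> \<rho> \<beta> x (\<lambda>_. y_inf \<delta> \<rho> \<beta>) \<and>
            (\<forall>x0 w. y_solution \<delta> \<rho> \<beta> x0 w \<and> w constant_on {0..} \<longrightarrow>
               (\<forall>s\<ge>0. w s = y_inf \<delta> \<rho> \<beta>)))
       \<and> (x \<noteq> y_inf \<delta> \<rho> \<beta> \<longrightarrow>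
            (\<forall>y. y_solution \<delta> \<rho> \<beta> x y \<and> y_bounds \<delta> \<rho> \<beta> x y \<longrightarrow>
               (strict_mono_on {0..} y \<or> strict_antimono_on {0..} y) \<and>
               (y \<longlongrightarrow> y_inf \<delta> \<rho> \<beta>) at_top))"
proof (intro conjI impI)
  obtain y where y: "y_solution \<delta> \<rho> \<beta> x y"
    using y_solution_exists[OF assms(1-3,5)] by blast
  have y_unique: "w s = y s" if "y_solution \<delta> \<rho> \<beta> x w" "0 \<le> s" for w s
    by (rule y_solution_unique[OF assms(3) that(1) y that(2)])
  have bounds: "y_bounds \<delta> \<rho> \<beta> x y"
    by (rule y_solution_bounds[OF assms(1-4) y])
  let ?z = "\<lambda>s. exp (\<delta> * s) * y s"
  have "(\<lambda>s. exp (- \<delta> * s) * ?z s) = y"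
    by (auto simp: exp_minus)
  then have z: "z_solution \<delta> \<rho> \<beta> x ?z"
    unfolding z_solution_iff_y_solution using y by simp
  have z_unique: "w s = ?z s" if "z_solution \<delta> \<rho> \<beta> x w" "0 \<le> s" for w s
    using y_unique[OF _ that(2)] that(1) unfolding z_solution_iff_y_solution
    by (force simp: exp_minus field_simps)
  show "\<exists>z\<in>C_set \<delta> \<rho> \<beta> x. z_solution \<delta> \<rho> \<beta> x z \<and> Ck_on 2 {0..} z \<and>
      (\<forall>w\<in>C_set \<delta> \<rho> \<beta> x. z_solution \<delta> \<rho> \<beta> x w \<longrightarrow> (\<forall>s\<ge>0. w s = z s))"
    using z y_solution_C2[OF y, of \<delta>] z_unique
    by (intro bexI[of _ ?z] C_set_of_y_bounds[OF y bounds]) blast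
  have "Ck_on 2 {0..} y"
    using y_solution_C2[OF y, of 0] by simp
  then show "\<exists>y. y_solution \<delta> \<rho> \<beta> x y \<and> Ck_on 2 {0..} y \<and> y_bounds \<delta> \<rho> \<beta> x y \<and>
      (\<forall>w. y_solution \<delta> \<rho> \<beta> x w \<and> y_bounds \<delta> \<rho> \<beta> x w \<longrightarrow> (\<forall>s\<ge>0. w s = y s))"
    using y bounds y_unique by (intro exI[of _ y]) blast
next
  assume "x = y_inf \<delta> \<rho> \<beta>"
  then show "y_solution \<delta> \<rho> \<beta> x (\<lambda>_. y_inf \<delta> \<rho> \<beta>)"
    using y_inf_solution[OF assms(1-3)] by simp
  show "\<forall>x0 w. y_solution \<delta> \<rho> \<beta> x0 w \<and> w constant_on {0..} \<longrightarrow> (\<forall>s\<ge>0. w s = y_inf \<delta> \<rho> \<beta>)"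
    using constant_y_solution[OF assms(1-3)] by blast
next
  assume "x \<noteq> y_inf \<delta> \<rho> \<beta>"
  then show "\<forall>y. y_solution \<delta> \<rho> \<beta> x y \<and> y_bounds \<delta> \<rho> \<beta> x y \<longrightarrow>
      (strict_mono_on {0..} y \<or> strict_antimono_on {0..} y) \<and> (y \<longlongrightarrow> y_inf \<delta> \<rho> \<beta>) at_top"
    using y_solution_monotone_convergent[OF assms(1-3)] by blast
qed

end
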